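(* For every integer $k\ge 3$, $$\lim_{|z|\to 1}\rho_{0,k+1}(z)=\frac{k}{2\pi}.$$
   Context: For an integer $k\ge 2$, $\rho_{0,k}$ denotes the Bergman kernel function of the punctured unit disk $\mathbb D^*=\{z\in\mathbb C: 0<|z|<1\}$ with the Poincaré metric $\omega=\frac{i\,dz\wedge d\bar z}{|z|^2(\log\frac1{|z|^2})^2}$, i.e. of the Hilbert space $\mathcal H_{0,k}$ of holomorphic functions $f$ on $\mathbb D^*$ with $\int_{\mathbb D^*}|f|^2(\log\frac{1}{|z|^2})^k\,\omega<\infty$: $\rho_{0,k}=(\log\frac1{|z|^2})^k\sum_i|f_i|^2$ for an orthonormal basis $(f_i)$. Explicitly, $$\rho_{0,k}(z)=\frac{(\log \frac{1}{|z|^2})^k}{2\pi (k-2)!}\sum_{a=1}^{\infty}a^{k-1}|z|^{2a}.$$ The limit is taken over $|z|<1$. *)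

theory Defs
  imports "HOL-Complex_Analysis.Complex_Analysis"
begin

definition punctured_disk :: "complex set" where
  "punctured_disk = {z. 0 < norm z \<and> norm z < 1}"

definition log_weight :: "complex \<Rightarrow> real" where
  "log_weight z = ln (1 / (norm z)\<^sup>2)"

(* Volume measure of the form i dz /\ d(cnj z) / (|z|^2 (log (1/|z|^2))^2).
   The factor 2 comes from i dz /\ d(cnj z) = 2 dx dy. *)
definition poincare_measure :: "complex measure" where
  "poincare_measure =
     density (restrict_space lborel punctured_disk)
       (\<lambda>z. ennreal (2 / ((norm z)\<^sup>2 * (log_weight z)\<^sup>2)))"

(* Functions on the punctured disk are represented by total functions that vanish
   outside it, so that equality in this set is equality on the punctured disk. *)
definition bergman_space :: "nat \<Rightarrow> (complex \<Rightarrow> complex) set" where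
  "bergman_space k =
     {f. f holomorphic_on punctured_disk \<and> (\<forall>z. z \<notin> punctured_disk \<longrightarrow> f z = 0) \<and>
         integrable poincare_measure (\<lambda>z. (norm (f z))\<^sup>2 * log_weight z ^ k)}"

definition bergman_inner ::
    "nat \<Rightarrow> (complex \<Rightarrow> complex) \<Rightarrow> (complex \<Rightarrow> complex) \<Rightarrow> complex" where
  "bergman_inner k f g =
     (\<integral>z. f z * cnj (g z) * of_real (log_weight z ^ k) \<partial>poincare_measure)"

definition bergman_norm :: "nat \<Rightarrow> (complex \<Rightarrow> complex) \<Rightarrow> real" where
  "bergman_norm k f = sqrt (\<integral>z. (norm (f z))\<^sup>2 * log_weight z ^ k \<partial>poincare_measure)"

(* Orthonormal basis in the Hilbert space sense: an orthonormal set whose finite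
   complex linear combinations are dense. *)
definition bergman_orthonormal_basis :: "nat \<Rightarrow> (complex \<Rightarrow> complex) set \<Rightarrow> bool" where
  "bergman_orthonormal_basis k B \<longleftrightarrow>
     B \<subseteq> bergman_space k \<and>
     (\<forall>f\<in>B. \<forall>g\<in>B. bergman_inner k f g = (if f = g then 1 else 0)) \<and>
     (\<forall>f\<in>bergman_space k. \<forall>\<epsilon>>0. \<exists>F c. finite F \<and> F \<subseteq> B \<and>
        bergman_norm k (\<lambda>z. f z - (\<Sum>b\<in>F. c b * b z)) < \<epsilon>)"

(* The basis is chosen once for each k, independently of z; the value does not depend
   on which orthonormal basis is chosen.  The relevant range is k \<ge> 2. *)
definition bergman_kernel_function :: "nat \<Rightarrow> complex \<Rightarrow> real" where
  "bergman_kernel_function k z =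
     log_weight z ^ k *
     (\<Sum>\<^sub>\<infinity>f\<in>(SOME B. bergman_orthonormal_basis k B). (norm (f z))\<^sup>2)"

end

theory Submission
  imports Defs "HOL-Probability.Distributions" "HOL-Real_Asymp.Real_Asymp"
begin

text \<open>
  Averaging over rotations turns the norm of a power series on a disk, with respect to any radial
  weight, into \<open>\<Sum>n. \<bar>c\<^sub>n\<bar>\<^sup>2 m\<^sub>n\<close>, where \<open>m\<^sub>n\<close> is the squared norm of \<open>z\<^sup>n\<close>.  With the weight \<open>1\<close> this
  gives the sub-mean-value inequality, by which a function \<open>f\<close> in the Bergman space is bounded near
  the puncture; so \<open>f\<close> extends to the unit disk, and its constant coefficient vanishes because
  \<open>m\<^sub>0 = \<infinity>\<close>.  For \<open>n \<ge> 1\<close> the pushforward of Lebesgue measure under \<open>log (1 / \<bar>z\<bar>\<^sup>2)\<close>, which has density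
  \<open>\<pi> exp (- t)\<close>, gives \<open>m\<^sub>n = 2 \<pi> (k - 2)! / n\<^bsup>k - 1\<^esup>\<close>.  Hence the normalised monomials form an orthonormal
  basis.

  Let \<open>S = \<Sum>n. \<bar>z\<bar>\<^bsup>2 n\<^esup> / m\<^sub>n\<close>, so that \<open>\<bar>f z\<bar>\<^sup>2 \<le> S \<parallel>f\<parallel>\<^sup>2\<close>, and let \<open>B\<close> be any orthonormal basis.  Applying this to
  \<open>\<Sum>b\<in>F. cnj (b z) b\<close> for finite \<open>F \<subseteq> B\<close> shows that \<open>\<Sum>b\<in>B. \<bar>b z\<bar>\<^sup>2 \<le> S\<close>; the reverse inequality follows by
  approximating the truncated reproducing kernel, whose value at \<open>z\<close> and squared norm both equal the
  partial sum of \<open>S\<close>, by linear combinations of \<open>B\<close>.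

  Finally, \<open>j! binom(n, j) \<le> n\<^sup>j \<le> j! binom(n + j, j)\<close> and the negative binomial series squeeze
  \<open>\<Sum>n. n\<^sup>j x\<^sup>n\<close> between \<open>j! x\<^sup>j / (1 - x)\<^bsup>j + 1\<^esup>\<close> and \<open>j! / (1 - x)\<^bsup>j + 1\<^esup>\<close>.
\<close>

section \<open>Rotation invariance of Lebesgue measure on the complex plane\<close>

text \<open>Both measures assign to a box the product of its side lengths. This makes iterated
  integration over real and imaginary parts available on the complex plane.\<close>

lemma lborel_complex_conv_pair:
  "(lborel :: complex measure) = distr (lborel \<Otimes>\<^sub>M lborel) borel (\<lambda>(x, y). Complex x y)"
proof (rule lborel_eqI)
  fix l u :: complex
  assume le: "\<And>b. b \<in> Basis \<Longrightarrow> l \<bullet> b \<le> u \<bullet> b"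
  from le have le': "Re l \<le> Re u" "Im l \<le> Im u"
    using le[of 1] le[of \<i>] by (auto simp: Basis_complex_def)
  have meas: "(\<lambda>(x, y). Complex x y) \<in> borel_measurable (lborel \<Otimes>\<^sub>M lborel)"
    by (auto simp: Complex_eq)
  have "emeasure (distr (lborel \<Otimes>\<^sub>M lborel) borel (\<lambda>(x, y). Complex x y)) (box l u)
     = emeasure (lborel \<Otimes>\<^sub>M lborel) ({Re l<..<Re u} \<times> {Im l<..<Im u})"
    using meas by (subst emeasure_distr)
       (auto intro!: arg_cong2[where f = emeasure] simp: box_def Basis_complex_def space_pair_measure)
  also have "\<dots> = ennreal (Re u - Re l) * ennreal (Im u - Im l)"
    using le' by (subst lborel.emeasure_pair_measure_Times) auto
  also have "\<dots> = ennreal (\<Prod>b\<in>Basis. (u - l) \<bullet> b)"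
    using le' by (auto simp: Basis_complex_def ennreal_mult')
  finally show "emeasure (distr (lborel \<Otimes>\<^sub>M lborel) borel (\<lambda>(x, y). Complex x y)) (box l u)
     = ennreal (\<Prod>b\<in>Basis. (u - l) \<bullet> b)" .
qed auto

lemma nn_integral_lborel_complex:
  assumes [measurable]: "g \<in> borel_measurable borel"
  shows "(\<integral>\<^sup>+z. g z \<partial>lborel) = (\<integral>\<^sup>+x. \<integral>\<^sup>+y. g (Complex x y) \<partial>lborel \<partial>lborel)"
    and "(\<integral>\<^sup>+z. g z \<partial>lborel) = (\<integral>\<^sup>+y. \<integral>\<^sup>+x. g (Complex x y) \<partial>lborel \<partial>lborel)"
proof -
  have [measurable]: "(\<lambda>p. Complex (fst p) (snd p)) \<in> borel_measurable (lborel \<Otimes>\<^sub>M lborel)"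
    by (auto simp: Complex_eq)
  have *: "(\<integral>\<^sup>+z. g z \<partial>lborel) = (\<integral>\<^sup>+p. g (Complex (fst p) (snd p)) \<partial>(lborel \<Otimes>\<^sub>M lborel))"
    by (subst lborel_complex_conv_pair) (subst nn_integral_distr, auto simp: case_prod_unfold)
  show 1: "(\<integral>\<^sup>+z. g z \<partial>lborel) = (\<integral>\<^sup>+x. \<integral>\<^sup>+y. g (Complex x y) \<partial>lborel \<partial>lborel)"
    unfolding * by (subst lborel.nn_integral_fst[symmetric]) auto
  show "(\<integral>\<^sup>+z. g z \<partial>lborel) = (\<integral>\<^sup>+y. \<integral>\<^sup>+x. g (Complex x y) \<partial>lborel \<partial>lborel)"
    unfolding * by (subst lborel_pair.nn_integral_snd[symmetric]) auto
qed

lemma Complex_measurable [measurable (raw)]: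
  assumes "f \<in> borel_measurable M" "g \<in> borel_measurable M"
  shows "(\<lambda>x. Complex (f x) (g x)) \<in> borel_measurable M"
  using assms by (auto simp: Complex_eq)

text \<open>The rotation is broken into one-dimensional affine substitutions, one per real
  coordinate, so that Tonelli and the scaling rule on the line suffice. The Jacobian factors |a| and
  1 / |a| cancel; the case a = 0 is a quarter turn, which swaps the coordinates up to sign.\<close>

lemma nn_integral_rotate:
  fixes c :: complex
  assumes [measurable]: "g \<in> borel_measurable borel" and c: "norm c = 1"
  shows "(\<integral>\<^sup>+z. g (c * z) \<partial>lborel) = (\<integral>\<^sup>+z. g z \<partial>lborel)"
proof -
  define a b where "a = Re c" and "b = Im c"
  have ab: "a\<^sup>2 + b\<^sup>2 = 1"
    using c by (metis a_def b_def cmod_power2 power_one)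
  have cab: "c * Complex x y = Complex (a * x - b * y) (b * x + a * y)" for x y
    by (simp add: complex_eq_iff a_def b_def algebra_simps)
  have "(\<integral>\<^sup>+z. g (c * z) \<partial>lborel) =
        (\<integral>\<^sup>+y. \<integral>\<^sup>+x. g (Complex (a * x - b * y) (b * x + a * y)) \<partial>lborel \<partial>lborel)"
    by (subst nn_integral_lborel_complex(2)) (auto simp: cab)
  also have "\<dots> = (\<integral>\<^sup>+z. g z \<partial>lborel)"
  proof (cases "a = 0")
    case True
    hence b: "b \<noteq> 0" "\<bar>b\<bar> = 1" using ab by (auto simp: power2_eq_1_iff)
    have "(\<integral>\<^sup>+y. \<integral>\<^sup>+x. g (Complex (a * x - b * y) (b * x + a * y)) \<partial>lborel \<partial>lborel)
       = (\<integral>\<^sup>+y. (\<integral>\<^sup>+x. g (Complex (0 + (-b) * y) (0 + b * x)) \<partial>lborel) \<partial>lborel)"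
      using True by simp
    also have "\<dots> = (\<integral>\<^sup>+y. (\<integral>\<^sup>+x. g (Complex (0 + (-b) * y) x) \<partial>lborel) \<partial>lborel)"
      using b
      by (subst nn_integral_real_affine[of "\<lambda>x. g (Complex _ x)" b 0]) auto
    also have "\<dots> = (\<integral>\<^sup>+y. (\<integral>\<^sup>+x. g (Complex y x) \<partial>lborel) \<partial>lborel)"
      using b
      by (subst nn_integral_real_affine[of "\<lambda>y. (\<integral>\<^sup>+x. g (Complex y x) \<partial>lborel)" "-b" 0]) auto
    also have "\<dots> = (\<integral>\<^sup>+z. g z \<partial>lborel)"
      by (subst nn_integral_lborel_complex(1)) auto
    finally show ?thesis .
  next
    case False
    have inv: "inverse (ennreal \<bar>a\<bar>) * ennreal \<bar>a\<bar> = 1"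
      using False by (simp add: inverse_ennreal flip: ennreal_mult)
    have bb: "b * b = 1 - a * a" using ab by (simp add: power2_eq_square)
    \<comment> \<open>For fixed \<open>y\<close> the new variable is u = a x - b y. Writing the
      second coordinate as (b / a) u + y / a leaves an affine substitution in \<open>y\<close> for
      fixed u; this is where a^2 + b^2 = 1 enters.\<close>
    have eq: "b * x + a * y = (b / a) * (a * x - b * y) + y / a" for x y
    proof -
      have "(b * b + a * a) * y = y" by (simp add: bb)
      thus ?thesis using False by (simp add: field_simps)
    qed
    have "(\<integral>\<^sup>+y. \<integral>\<^sup>+x. g (Complex (a * x - b * y) (b * x + a * y)) \<partial>lborel \<partial>lborel)
       = (\<integral>\<^sup>+y. inverse (ennreal \<bar>a\<bar>) * (ennreal \<bar>a\<bar> * \<integral>\<^sup>+x. g (Complex (- b * y + a * x) ((b / a) * (- b * y + a * x) + y / a)) \<partial>lborel) \<partial>lborel)"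
      using False by (simp add: eq inv mult.assoc[symmetric])
    also have "\<dots> = (\<integral>\<^sup>+y. inverse (ennreal \<bar>a\<bar>) * (\<integral>\<^sup>+u. g (Complex u ((b / a) * u + y / a)) \<partial>lborel) \<partial>lborel)"
      using False
      by (subst nn_integral_real_affine[of "\<lambda>u. g (Complex u ((b / a) * u + _ / a))" a, symmetric]) auto
    also have "\<dots> = (\<integral>\<^sup>+u. inverse (ennreal \<bar>a\<bar>) * (\<integral>\<^sup>+y. g (Complex u ((b / a) * u + y / a)) \<partial>lborel) \<partial>lborel)"
      by (simp add: nn_integral_cmult, subst lborel_pair.Fubini') auto
    also have "\<dots> = (\<integral>\<^sup>+u. (ennreal \<bar>1 / a\<bar> * \<integral>\<^sup>+y. g (Complex u ((b / a) * u + (1 / a) * y)) \<partial>lborel) \<partial>lborel)"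
      using False by (simp add: inverse_ennreal divide_inverse mult.commute)
    also have "\<dots> = (\<integral>\<^sup>+u. (\<integral>\<^sup>+v. g (Complex u v) \<partial>lborel) \<partial>lborel)"
      using False
      by (subst nn_integral_real_affine[of "\<lambda>v. g (Complex _ v)" "1/a", symmetric]) auto
    also have "\<dots> = (\<integral>\<^sup>+z. g z \<partial>lborel)"
      by (subst nn_integral_lborel_complex(1)) auto
    finally show ?thesis .
  qed
  finally show ?thesis .
qed

lemma lborel_distr_rotate:
  fixes c :: complex
  assumes "norm c = 1"
  shows "distr lborel borel ((*) c) = lborel"
proof (rule measure_eqI)
  fix A assume "A \<in> sets (distr lborel borel ((*) c))"
  hence [measurable]: "A \<in> sets borel" by simp
  have "emeasure (distr lborel borel ((*) c)) A = (\<integral>\<^sup>+z. indicator A (c * z) \<partial>lborel)"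
    by (subst nn_integral_indicator[symmetric], simp, subst nn_integral_distr) auto
  also have "\<dots> = emeasure lborel A"
    using assms by (subst nn_integral_rotate) auto
  finally show "emeasure (distr lborel borel ((*) c)) A = emeasure lborel A" .
qed simp

lemma ball_measurable [measurable]:
  fixes a :: "'a :: {metric_space, second_countable_topology}"
  shows "ball a r \<in> sets borel"
  by simp

lemma cnj_measurable [measurable]: "cnj \<in> borel_measurable borel"
  by (intro borel_measurable_continuous_onI continuous_intros)

section \<open>Weighted norms of power series on disks\<close>

lemma LBINT_cis_int:
  fixes k :: int
  shows "(LBINT t:{0..2*pi}. cis (of_int k * t)) = (if k = 0 then of_real (2 * pi) else 0)"
proof (cases "k = 0")
  case True
  thus ?thesis by (simp add: set_lebesgue_integral_def scaleR_conv_of_real)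
next
  case False
  define F where "F t = cis (of_int k * t) / (\<i> * of_int k)" for t :: real
  have "(LBINT t:{0..2*pi}. cis (of_int k * t)) = F (2 * pi) - F 0"
    unfolding set_lebesgue_integral_def
  proof (rule integral_FTC_atLeastAtMost)
    fix t :: real
    have "((\<lambda>z. exp (\<i> * of_int k * z) / (\<i> * of_int k)) has_field_derivative exp (\<i> * of_int k * of_real t)) (at (of_real t))"
      using False by (auto intro!: derivative_eq_intros)
    from has_vector_derivative_real_field[OF this]
    show "(F has_vector_derivative cis (of_int k * t)) (at t within {0..2*pi})"
      by (simp add: F_def[abs_def] cis_conv_exp mult_ac)
  qed (auto intro!: continuous_intros)
  also have "F (2 * pi) = F 0"
    using cis_multiple_2pi[of "of_int k"] by (simp add: F_def mult_ac)
  finally show ?thesis using False by simp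
qed

text \<open>Parseval on the circle. Finite sums follow by expanding the square and using the
  orthogonality of the characters; the passage to the limit is dominated by the constant square of
  the sum of all |d n|.\<close>

lemma sums_norm_square_circle:
  fixes d :: "nat \<Rightarrow> complex"
  assumes d: "summable (\<lambda>n. norm (d n))"
  shows "(\<lambda>n. (norm (d n))\<^sup>2) sums ((LBINT t:{0..2*pi}. (norm (\<Sum>n. d n * cis t ^ n))\<^sup>2) / (2 * pi))"
proof -
  define s where "s N t = (\<Sum>n<N. d n * cis t ^ n)" for N t
  define h where "h t = (\<Sum>n. d n * cis t ^ n)" for t
  have summ: "summable (\<lambda>n. d n * cis t ^ n)" for t
    by (rule summable_norm_cancel) (simp add: norm_mult norm_power d)
  have lim: "(\<lambda>N. s N t) \<longlonglongrightarrow> h t" for t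
    unfolding s_def h_def using summ summable_LIMSEQ by blast
  have bound: "norm (s N t) \<le> (\<Sum>n. norm (d n))" for N t
  proof -
    have "norm (s N t) \<le> (\<Sum>n<N. norm (d n * cis t ^ n))" unfolding s_def by (rule norm_sum)
    also have "\<dots> \<le> (\<Sum>n. norm (d n))"
      using d by (simp add: norm_mult norm_power) (intro sum_le_suminf, auto)
    finally show ?thesis .
  qed
  have scont: "continuous_on A (s N)" for N A
    unfolding s_def by (intro continuous_intros)
  have smeas [measurable]: "s N \<in> borel_measurable borel" for N
    by (intro borel_measurable_continuous_onI scont)
  have hmeas [measurable]: "h \<in> borel_measurable borel"
    by (rule borel_measurable_LIMSEQ_metric[OF smeas]) (use lim in auto)
  have eq: "(LBINT t:{0..2*pi}. (norm (s N t))\<^sup>2) = 2 * pi * (\<Sum>n<N. (norm (d n))\<^sup>2)" for N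
  proof -
    have expand: "complex_of_real ((norm (s N t))\<^sup>2) =
       (\<Sum>m<N. \<Sum>n<N. d m * cnj (d n) * cis (of_int (int m - int n) * t))" for t
    proof -
      have "complex_of_real ((norm (s N t))\<^sup>2) = s N t * cnj (s N t)"
        by (simp only: complex_norm_square)
      also have "\<dots> = (\<Sum>m<N. \<Sum>n<N. (d m * cis t ^ m) * cnj (d n * cis t ^ n))"
        by (simp add: s_def cnj_sum sum_product)
      also have "\<dots> = (\<Sum>m<N. \<Sum>n<N. d m * cnj (d n) * cis (of_int (int m - int n) * t))"
        by (intro sum.cong refl)
           (simp add: Complex.DeMoivre cis_cnj cis_mult algebra_simps)
      finally show ?thesis .
    qed
    have int: "integrable lborel (\<lambda>t. indicator {0..2*pi} t *\<^sub>R (a * cis (of_int k * t)))" for a and k :: int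
      unfolding set_integrable_def[symmetric]
      by (intro borel_integrable_atLeastAtMost' continuous_intros)
    have "complex_of_real (LBINT t:{0..2*pi}. (norm (s N t))\<^sup>2) =
          (LBINT t:{0..2*pi}. complex_of_real ((norm (s N t))\<^sup>2))"
      by (simp add: set_lebesgue_integral_def flip: integral_complex_of_real)
         (simp add: scaleR_conv_of_real)
    also have "\<dots> = (\<Sum>m<N. LBINT t:{0..2*pi}. \<Sum>n<N. d m * cnj (d n) * cis (of_int (int m - int n) * t))"
      unfolding expand set_lebesgue_integral_def scaleR_sum_right
      by (rule Bochner_Integration.integral_sum, rule Bochner_Integration.integrable_sum, rule int)
    also have "\<dots> = (\<Sum>m<N. \<Sum>n<N. LBINT t:{0..2*pi}. d m * cnj (d n) * cis (of_int (int m - int n) * t))"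
      unfolding set_lebesgue_integral_def scaleR_sum_right
      by (rule sum.cong[OF refl], rule Bochner_Integration.integral_sum, rule int)
    also have "\<dots> = (\<Sum>m<N. \<Sum>n<N. if m = n then 2 * pi * (norm (d m))\<^sup>2 else 0)"
      unfolding of_real_sum
    proof (intro sum.cong refl)
      fix m n
      have "(LBINT t:{0..2*pi}. d m * cnj (d n) * cis (of_int (int m - int n) * t))
         = d m * cnj (d n) * (LBINT t:{0..2*pi}. cis (of_int (int m - int n) * t))"
        by (rule set_integral_mult_right)
      also have "\<dots> = complex_of_real (if m = n then 2 * pi * (norm (d m))\<^sup>2 else 0)"
        using complex_norm_square[of "d m"] by (subst LBINT_cis_int) auto
      finally show "(LBINT t:{0..2*pi}. d m * cnj (d n) * cis (of_int (int m - int n) * t)) = \<dots>" .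
    qed
    also have "(\<Sum>m<N. \<Sum>n<N. if m = n then 2 * pi * (norm (d m))\<^sup>2 else 0) = 2 * pi * (\<Sum>n<N. (norm (d n))\<^sup>2)"
      by (simp add: sum_distrib_left)
    finally show ?thesis by (simp only: of_real_eq_iff)
  qed
  have "(\<lambda>N. LBINT t:{0..2*pi}. (norm (s N t))\<^sup>2) \<longlonglongrightarrow> (LBINT t:{0..2*pi}. (norm (h t))\<^sup>2)"
    unfolding set_lebesgue_integral_def
  proof (rule integral_dominated_convergence)
    show "integrable lborel (\<lambda>t. indicator {0..2*pi} t *\<^sub>R (\<Sum>n. norm (d n))\<^sup>2)"
      by (intro integrable_real_indicator integrable_scaleR_left) auto
    show "AE t in lborel. (\<lambda>N. indicator {0..2*pi} t *\<^sub>R (norm (s N t))\<^sup>2) \<longlonglongrightarrow> indicator {0..2*pi} t *\<^sub>R (norm (h t))\<^sup>2"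
      by (intro AE_I2 tendsto_intros lim)
    show "AE t in lborel. norm (indicator {0..2*pi} t *\<^sub>R (norm (s N t))\<^sup>2) \<le> indicator {0..2*pi} t *\<^sub>R (\<Sum>n. norm (d n))\<^sup>2" for N
      by (auto split: split_indicator intro!: power_mono bound)
  qed auto
  hence "(\<lambda>N. (2 * pi * (\<Sum>n<N. (norm (d n))\<^sup>2)) / (2 * pi)) \<longlonglongrightarrow> (LBINT t:{0..2*pi}. (norm (h t))\<^sup>2) / (2 * pi)"
    unfolding eq by (intro tendsto_divide) auto
  thus ?thesis by (simp add: sums_def h_def)
qed

text \<open>Parseval in \<open>ennreal\<close>, the form that combines with Tonelli without
  finiteness assumptions. Uniform convergence makes the sum continuous, which gives integrability on
  the compact interval.\<close>

lemma nn_integral_norm_square_circle: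
  fixes d :: "nat \<Rightarrow> complex"
  assumes d: "summable (\<lambda>n. norm (d n))"
  shows "(\<integral>\<^sup>+t. ennreal ((norm (\<Sum>n. d n * cis t ^ n))\<^sup>2) * indicator {0..2*pi} t \<partial>lborel) =
         ennreal (2 * pi) * (\<Sum>n. ennreal ((norm (d n))\<^sup>2))"
proof -
  define h where "h t = (\<Sum>n. d n * cis t ^ n)" for t
  have ucont: "uniform_limit UNIV (\<lambda>N t. \<Sum>n<N. d n * cis t ^ n) h sequentially"
    unfolding h_def by (rule Weierstrass_m_test[OF _ d]) (simp add: norm_mult norm_power)
  have hcont: "continuous_on UNIV h"
    by (rule uniform_limit_theorem[OF _ ucont]) (auto intro!: always_eventually continuous_intros)
  have "set_integrable lborel {0..2*pi} (\<lambda>t. (norm (h t))\<^sup>2)"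
    by (intro borel_integrable_atLeastAtMost' continuous_intros continuous_on_subset[OF hcont]) auto
  hence int: "integrable lborel (\<lambda>t. (norm (h t))\<^sup>2 * indicator {0..2*pi} t)"
    by (simp add: set_integrable_def mult.commute)
  have "(\<integral>\<^sup>+t. ennreal ((norm (h t))\<^sup>2) * indicator {0..2*pi} t \<partial>lborel) =
        (\<integral>\<^sup>+t. ennreal ((norm (h t))\<^sup>2 * indicator {0..2*pi} t) \<partial>lborel)"
    by (intro nn_integral_cong) (auto split: split_indicator)
  also have "\<dots> = ennreal (LBINT t:{0..2*pi}. (norm (h t))\<^sup>2)"
    by (subst nn_integral_eq_integral[OF int]) (auto simp: set_lebesgue_integral_def mult.commute)
  also have "(LBINT t:{0..2*pi}. (norm (h t))\<^sup>2) = 2 * pi * (\<Sum>n. (norm (d n))\<^sup>2)"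
    using sums_unique[OF sums_norm_square_circle[OF d]] by (simp add: h_def field_simps)
  also have "ennreal \<dots> = ennreal (2 * pi) * (\<Sum>n. ennreal ((norm (d n))\<^sup>2))"
  proof -
    have summ: "summable (\<lambda>n. (norm (d n))\<^sup>2)"
      using sums_norm_square_circle[OF d] by (rule sums_summable)
    have "ennreal (2 * pi * (\<Sum>n. (norm (d n))\<^sup>2)) = ennreal (2 * pi) * ennreal (\<Sum>n. (norm (d n))\<^sup>2)"
      by (rule ennreal_mult) (auto intro: suminf_nonneg summ)
    also have "ennreal (\<Sum>n. (norm (d n))\<^sup>2) = (\<Sum>n. ennreal ((norm (d n))\<^sup>2))"
      by (rule suminf_ennreal2[symmetric]) (auto intro: summ)
    finally show ?thesis .
  qed
  finally show ?thesis by (simp add: h_def)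
qed

text \<open>The weight is rotation invariant, so averaging over rotations leaves the integral
  unchanged; exchanging the order of integration puts Parseval on each circle, which removes the
  mixed terms. Both sides may be infinite, and this case is used below to exclude constant
  terms.\<close>

lemma nn_integral_power_series_ball:
  fixes c :: "nat \<Rightarrow> complex" and v :: "complex \<Rightarrow> ennreal"
  assumes h: "\<And>z. norm z < R \<Longrightarrow> (\<lambda>n. c n * z ^ n) sums h z"
    and v [measurable]: "v \<in> borel_measurable borel"
    and rot: "\<And>\<zeta> z. norm \<zeta> = 1 \<Longrightarrow> v (\<zeta> * z) = v z"
  shows "(\<integral>\<^sup>+z. ennreal ((norm (h z))\<^sup>2) * v z * indicator (ball 0 R) z \<partial>lborel) =
         (\<Sum>n. ennreal ((norm (c n))\<^sup>2) * (\<integral>\<^sup>+z. ennreal (norm z ^ (2 * n)) * v z * indicator (ball 0 R) z \<partial>lborel))"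
proof -
  define G where "G z = ennreal ((norm (h z))\<^sup>2) * v z * indicator (ball 0 R) z" for z
  \<comment> \<open>Outside the ball \<open>h\<close> is arbitrary, so measurability is proved for a
    series that agrees with \<open>h\<close> on the ball and is evaluated at 0 elsewhere.\<close>
  define h' where "h' z = (\<Sum>n. c n * (z * indicator (ball 0 R) z) ^ n)" for z
  have h': "(\<lambda>n. c n * (z * indicator (ball 0 R) z) ^ n) sums h' z" for z
  proof (cases "R > 0")
    case True
    hence "norm (z * indicator (ball 0 R) z) < R" by (auto split: split_indicator)
    thus ?thesis unfolding h'_def using h by (simp add: sums_iff)
  next
    case False
    hence "z * indicator (ball 0 R) z = 0"
      using order.trans[OF _ norm_ge_zero[of z], of R] by (auto simp: indicator_def)
    thus ?thesis unfolding h'_def using summable_sums[OF sums_summable[OF powser_sums_zero[of c]]]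
      by (simp only:)
  qed
  have "h' \<in> borel_measurable borel"
    unfolding h'_def[abs_def] by measurable
  have "h z = h' z" if "z \<in> ball 0 R" for z
    using h[of z] that by (simp add: h'_def sums_iff)
  hence G_alt: "G = (\<lambda>z. ennreal ((norm (h' z))\<^sup>2) * v z * indicator (ball 0 R) z)"
    by (auto simp: G_def fun_eq_iff split: split_indicator)
  have [measurable]: "h' \<in> borel_measurable borel" by fact
  have Gm [measurable]: "G \<in> borel_measurable borel"
    unfolding G_alt by measurable
  have [measurable]: "cis \<in> borel_measurable borel"
    by (intro borel_measurable_continuous_onI continuous_intros)
  have circ: "(\<integral>\<^sup>+t. G (cis t * z) * indicator {0..2*pi} t \<partial>lborel) =
        ennreal (2 * pi) * (\<Sum>n. ennreal ((norm (c n))\<^sup>2) * (ennreal (norm z ^ (2 * n)) * v z * indicator (ball 0 R) z))" for z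
  proof (cases "z \<in> ball 0 R")
    case True
    define d where "d n = c n * z ^ n" for n
    \<comment> \<open>Convergence at a slightly larger radius yields absolute convergence at
      \<open>z\<close>.\<close>
    have "summable (\<lambda>n. norm (d n))"
    proof -
      obtain r where r: "norm z < r" "r < R" using True dense[of "norm z" R] by auto
      have "r > 0" using r norm_ge_zero[of z] by linarith
      with r have "norm (of_real r :: complex) < R" by simp
      hence "summable (\<lambda>n. c n * of_real r ^ n)" using h sums_summable by blast
      thus ?thesis unfolding d_def
        by (rule powser_insidea) (use r \<open>r > 0\<close> in simp)
    qed
    note circle = nn_integral_norm_square_circle[OF this]
    have hd: "h (cis t * z) = (\<Sum>n. d n * cis t ^ n)" for t
      using h[of "cis t * z"] True by (simp add: sums_iff d_def norm_mult power_mult_distrib mult_ac)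
    have "(\<integral>\<^sup>+t. G (cis t * z) * indicator {0..2*pi} t \<partial>lborel) =
          (\<integral>\<^sup>+t. v z * (ennreal ((norm (\<Sum>n. d n * cis t ^ n))\<^sup>2) * indicator {0..2*pi} t) \<partial>lborel)"
      using True by (intro nn_integral_cong, simp add: G_def hd rot norm_mult) (simp add: mult_ac)
    also have "\<dots> = v z * (\<integral>\<^sup>+t. ennreal ((norm (\<Sum>n. d n * cis t ^ n))\<^sup>2) * indicator {0..2*pi} t \<partial>lborel)"
      by (intro nn_integral_cmult) measurable
    also have "\<dots> = ennreal (2 * pi) * (\<Sum>n. v z * ennreal ((norm (d n))\<^sup>2))"
      unfolding circle by (subst ennreal_suminf_cmult) (simp add: mult_ac)
    also have "(\<lambda>n. v z * ennreal ((norm (d n))\<^sup>2)) =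
        (\<lambda>n. ennreal ((norm (c n))\<^sup>2) * (ennreal (norm z ^ (2 * n)) * v z * indicator (ball 0 R) z))"
      using True
      by (simp add: d_def fun_eq_iff norm_mult norm_power power_mult_distrib ennreal_mult mult_ac flip: power_mult)
    finally show ?thesis .
  next
    case False
    thus ?thesis by (simp add: G_def norm_mult)
  qed
  have "ennreal (2 * pi) * (\<integral>\<^sup>+z. G z \<partial>lborel) = (\<integral>\<^sup>+z. G z \<partial>lborel) * emeasure lborel {0..2*pi}"
    by (simp add: mult.commute)
  also have "\<dots> = (\<integral>\<^sup>+t. (\<integral>\<^sup>+z. G z \<partial>lborel) * indicator {0..2*pi} t \<partial>lborel)"
    by (subst nn_integral_cmult_indicator) auto
  also have "\<dots> = (\<integral>\<^sup>+t. (\<integral>\<^sup>+z. G (cis t * z) * indicator {0..2*pi} t \<partial>lborel) \<partial>lborel)"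
    by (subst nn_integral_multc) (auto simp: nn_integral_rotate)
  also have "\<dots> = (\<integral>\<^sup>+z. (\<integral>\<^sup>+t. G (cis t * z) * indicator {0..2*pi} t \<partial>lborel) \<partial>lborel)"
    by (rule lborel_pair.Fubini') measurable
  also have "\<dots> = ennreal (2 * pi) * (\<Sum>n. ennreal ((norm (c n))\<^sup>2) * (\<integral>\<^sup>+z. (ennreal (norm z ^ (2 * n)) * v z * indicator (ball 0 R) z) \<partial>lborel))"
    unfolding circ by (simp add: nn_integral_cmult nn_integral_suminf)
  finally show ?thesis
    by (simp add: ennreal_mult_cancel_left G_def)
qed

section \<open>The weighted measure of the Bergman space\<close>

lemma open_punctured_disk: "open punctured_disk"
proof -
  have eq: "punctured_disk = ball 0 1 - {0}"
    by (auto simp: punctured_disk_def)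
  show ?thesis unfolding eq by (intro open_delete open_ball)
qed

lemma punctured_disk_measurable [measurable]: "punctured_disk \<in> sets borel"
  using open_punctured_disk by simp

section \<open>The radial variable log (1 / |z|^2)\<close>

lemma log_weight_measurable [measurable]: "log_weight \<in> borel_measurable borel"
  unfolding log_weight_def[abs_def] by measurable

lemma log_weight_eq: "z \<noteq> 0 \<Longrightarrow> log_weight z = - 2 * ln (norm z)"
  by (simp add: log_weight_def ln_div ln_realpow)

lemma log_weight_pos: "z \<in> punctured_disk \<Longrightarrow> 0 < log_weight z"
  by (simp add: punctured_disk_def log_weight_eq)

lemma exp_log_weight: "z \<noteq> 0 \<Longrightarrow> exp (- log_weight z) = (norm z)\<^sup>2"
  by (simp add: log_weight_eq exp_double)

text \<open>Two measures on the line are identified from their values on half-lines. The points of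
  the punctured disk with \<open>log_weight\<close> above x >= 0 form a punctured disk of radius exp
  (- x / 2), whose area pi exp (- x) is also the tail of the density pi exp (- t).\<close>

lemma nn_integral_radial:
  assumes [measurable]: "g \<in> borel_measurable borel"
  shows "(\<integral>\<^sup>+z. g (log_weight z) * indicator punctured_disk z \<partial>lborel) =
         ennreal pi * (\<integral>\<^sup>+t. g t * ennreal (exp (- t)) * indicator {0<..} t \<partial>lborel)"
proof -
  define M where "M = distr (restrict_space lborel punctured_disk) borel log_weight"
  define N where "N = density lborel (\<lambda>t. ennreal (pi * exp (- t)) * indicator {0<..} t)"
  have L': "log_weight \<in> borel_measurable (restrict_space lborel punctured_disk)"
    by (rule measurable_restrict_space1) simp
  \<comment> \<open>The maximum with 0 appears because \<open>log_weight\<close> is positive on the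
    punctured disk, so a negative threshold excludes nothing.\<close>
  have M: "emeasure M {x<..} = ennreal (pi * exp (- max 0 x))" for x
  proof -
    have "emeasure M {x<..} = emeasure lborel {z \<in> punctured_disk. x < log_weight z}"
      unfolding M_def using L'
      by (subst emeasure_distr) (auto simp: emeasure_restrict_space space_restrict_space
           intro!: arg_cong2[where f = emeasure])
    also have "{z \<in> punctured_disk. x < log_weight z} = ball 0 (exp (- max 0 x / 2)) - {0}"
    proof (intro set_eqI)
      fix z :: complex
      show "z \<in> {z \<in> punctured_disk. x < log_weight z} \<longleftrightarrow> z \<in> ball 0 (exp (- max 0 x / 2)) - {0}"
      proof (cases "z = 0")
        case False
        have "norm z < 1 \<longleftrightarrow> ln (norm z) < 0" using False by simp
        moreover have "norm z < exp (- max 0 x / 2) \<longleftrightarrow> ln (norm z) < - max 0 x / 2"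
          using False by (metis exp_gt_zero ln_exp ln_less_cancel_iff zero_less_norm_iff)
        moreover have "log_weight z = - 2 * ln (norm z)"
          using False by (simp add: log_weight_def ln_div ln_realpow)
        moreover have "z \<in> {z \<in> punctured_disk. x < log_weight z} \<longleftrightarrow> norm z < 1 \<and> x < log_weight z"
          using False by (simp add: punctured_disk_def)
        moreover have "z \<in> ball 0 (exp (- max 0 x / 2)) - {0} \<longleftrightarrow> norm z < exp (- max 0 x / 2)"
          using False by simp
        moreover have "a < 0 \<and> x < - 2 * a \<longleftrightarrow> a < - max 0 x / 2" for a :: real
          by (cases "x \<ge> 0") (auto simp: max_def)
        ultimately show ?thesis by (simp only:)
      qed (simp add: punctured_disk_def)
    qed
    also have "emeasure lborel \<dots> = emeasure lborel (ball (0::complex) (exp (- max 0 x / 2)))"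
      by (intro emeasure_Diff_null_set) auto
    also have "\<dots> = ennreal (pi * exp (- max 0 x))"
      by (simp add: emeasure_ball unit_ball_vol_2 flip: exp_double)
    finally show ?thesis .
  qed
  have N: "emeasure N {x<..} = ennreal (pi * exp (- max 0 x))" for x
  proof -
    have "emeasure N {x<..} = (\<integral>\<^sup>+t. ennreal (pi * exp (- t)) * indicator {max 0 x<..} t \<partial>lborel)"
      unfolding N_def by (subst emeasure_density) (auto intro!: nn_integral_cong split: split_indicator)
    also have "\<dots> = (\<integral>\<^sup>+t. ennreal (pi * exp (- t)) * indicator {max 0 x..} t \<partial>lborel)"
    proof (rule nn_integral_cong_AE)
      show "AE t in lborel. ennreal (pi * exp (- t)) * indicator {max 0 x<..} t =
              ennreal (pi * exp (- t)) * indicator {max 0 x..} t"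
        using AE_lborel_singleton[of "max 0 x"] by eventually_elim (auto split: split_indicator)
    qed
    also have "\<dots> = ennreal (0 - (- pi * exp (- max 0 x)))"
    proof (rule nn_integral_FTC_atLeast)
      show "((\<lambda>x. - pi * exp (- x)) \<longlongrightarrow> 0) at_top"
        by (intro tendsto_mult_right_zero filterlim_compose[OF exp_at_bot] filterlim_uminus_at_bot_at_top)
    qed (auto intro!: derivative_eq_intros)
    finally show ?thesis by simp
  qed
  have "M = N"
    by (rule measure_eqI_lessThan) (simp_all add: M_def N_def M[unfolded M_def] N[unfolded N_def])
  have "(\<integral>\<^sup>+z. g (log_weight z) * indicator punctured_disk z \<partial>lborel) = (\<integral>\<^sup>+t. g t \<partial>M)"
    unfolding M_def using L'
    by (subst nn_integral_distr) (auto simp: nn_integral_restrict_space)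
  also have "\<dots> = (\<integral>\<^sup>+t. ennreal (pi * exp (- t)) * indicator {0<..} t * g t \<partial>lborel)"
    unfolding \<open>M = N\<close> N_def by (subst nn_integral_density) auto
  also have "\<dots> = ennreal pi * (\<integral>\<^sup>+t. g t * ennreal (exp (- t)) * indicator {0<..} t \<partial>lborel)"
    by (subst nn_integral_cmult[symmetric]) (auto simp: ennreal_mult mult_ac)
  finally show ?thesis .
qed

text \<open>This is the Poincare density times \<open>log_weight z ^ k\<close> with the powers of
  the logarithm combined; because of truncated subtraction it is meant for k >= 2. The value 0
  outside the punctured disk allows integration over the whole plane.\<close>

definition bergman_density :: "nat \<Rightarrow> complex \<Rightarrow> real" where
  "bergman_density k z =
     (if z \<in> punctured_disk then 2 * log_weight z ^ (k - 2) / (norm z)\<^sup>2 else 0)"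

definition bergman_measure :: "nat \<Rightarrow> complex measure" where
  "bergman_measure k = density lborel (\<lambda>z. ennreal (bergman_density k z))"

text \<open>The squared norm of \<open>z ^ n\<close> for \<open>n \<ge> 1\<close>.  The true value at \<open>n = 0\<close> is infinite; division by
  zero yields \<open>0\<close> there instead, so that the term \<open>n = 0\<close> drops out of \<open>\<Sum>n. norm z ^ (2 * n) / monomial_norm2 k n\<close>.\<close>
definition monomial_norm2 :: "nat \<Rightarrow> nat \<Rightarrow> real" where
  "monomial_norm2 k n = 2 * pi * fact (k - 2) / real n ^ (k - 1)"

lemma monomial_norm2_pos: "n \<ge> 1 \<Longrightarrow> monomial_norm2 k n > 0"
  by (simp add: monomial_norm2_def)

lemma monomial_norm2_0: "k \<ge> 2 \<Longrightarrow> monomial_norm2 k 0 = 0"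
  by (simp add: monomial_norm2_def)

lemma monomial_norm2_nonneg [simp]: "0 \<le> monomial_norm2 k n"
  by (simp add: monomial_norm2_def)

lemma bergman_density_nonneg [simp]: "0 \<le> bergman_density k z"
  using log_weight_pos[of z] by (auto simp: bergman_density_def)

lemma bergman_density_measurable [measurable]: "bergman_density k \<in> borel_measurable borel"
  unfolding bergman_density_def[abs_def] by measurable

lemma sets_bergman_measure [measurable_cong, simp]: "sets (bergman_measure k) = sets borel"
  by (simp add: bergman_measure_def)

lemma space_bergman_measure [simp]: "space (bergman_measure k) = UNIV"
  by (simp add: bergman_measure_def)

lemma bergman_density_rotate: "norm \<zeta> = 1 \<Longrightarrow> bergman_density k (\<zeta> * z) = bergman_density k z"
  by (auto simp: bergman_density_def punctured_disk_def log_weight_def norm_mult)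

lemma bergman_density_eq:
  assumes "k \<ge> 2" "z \<in> punctured_disk"
  shows "bergman_density k z = 2 / ((norm z)\<^sup>2 * (log_weight z)\<^sup>2) * log_weight z ^ k"
proof -
  have "log_weight z ^ k = log_weight z ^ (k - 2) * (log_weight z)\<^sup>2"
    using assms(1) by (metis le_add_diff_inverse2 power_add)
  thus ?thesis using assms log_weight_pos[OF assms(2)] by (simp add: bergman_density_def)
qed

text \<open>The weight is moved from the integrand into the measure. A Banach-valued
  \<open>g\<close> covers both the real integrals behind norms and the complex ones behind inner
  products.\<close>

lemma
  fixes g :: "complex \<Rightarrow> 'a :: {banach, second_countable_topology}"
  assumes k: "k \<ge> 2" and [measurable]: "g \<in> borel_measurable borel"
  shows integrable_poincare_iff:
          "integrable poincare_measure (\<lambda>z. log_weight z ^ k *\<^sub>R g z) \<longleftrightarrow> integrable (bergman_measure k) g"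
    and integral_poincare_eq:
          "(\<integral>z. log_weight z ^ k *\<^sub>R g z \<partial>poincare_measure) = (\<integral>z. g z \<partial>bergman_measure k)"
proof -
  let ?w = "\<lambda>z::complex. 2 / ((norm z)\<^sup>2 * (log_weight z)\<^sup>2)"
  have eq: "indicator punctured_disk z *\<^sub>R (?w z *\<^sub>R (log_weight z ^ k *\<^sub>R g z)) = bergman_density k z *\<^sub>R g z" for z
    using bergman_density_eq[OF k, of z] by (auto simp: bergman_density_def split: split_indicator)
  have [measurable]: "?w \<in> borel_measurable (restrict_space lborel punctured_disk)"
    "(\<lambda>z. log_weight z ^ k *\<^sub>R g z) \<in> borel_measurable (restrict_space lborel punctured_disk)"
    by (rule measurable_restrict_space1, measurable)+
  show "integrable poincare_measure (\<lambda>z. log_weight z ^ k *\<^sub>R g z) \<longleftrightarrow> integrable (bergman_measure k) g"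
    unfolding poincare_measure_def bergman_measure_def
    by (subst (1 2) integrable_density) (auto simp: integrable_restrict_space simp del: scaleR_scaleR simp flip: eq)
  show "(\<integral>z. log_weight z ^ k *\<^sub>R g z \<partial>poincare_measure) = (\<integral>z. g z \<partial>bergman_measure k)"
    unfolding poincare_measure_def bergman_measure_def
    by (subst (1 2) integral_density) (auto simp: integral_restrict_space simp del: scaleR_scaleR simp flip: eq)
qed

section \<open>The Bergman space, its norm and its inner product in terms of
  \<open>bergman_measure\<close>\<close>

lemma holomorphic_vanishing_measurable:
  assumes "f holomorphic_on punctured_disk" "\<And>z. z \<notin> punctured_disk \<Longrightarrow> f z = 0"
  shows "f \<in> borel_measurable borel"
proof -
  have "(\<lambda>z. indicator punctured_disk z *\<^sub>R f z) \<in> borel_measurable borel"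
    by (intro borel_measurable_continuous_on_indicator holomorphic_on_imp_continuous_on assms) simp
  also have "(\<lambda>z. indicator punctured_disk z *\<^sub>R f z) = f"
    using assms(2) by (auto simp: fun_eq_iff split: split_indicator)
  finally show ?thesis .
qed

lemma bergman_space_measurable: "f \<in> bergman_space k \<Longrightarrow> f \<in> borel_measurable borel"
  by (rule holomorphic_vanishing_measurable) (auto simp: bergman_space_def)

lemma bergman_space_iff:
  assumes "k \<ge> 2"
  shows "f \<in> bergman_space k \<longleftrightarrow> f holomorphic_on punctured_disk \<and> (\<forall>z. z \<notin> punctured_disk \<longrightarrow> f z = 0) \<and>
           integrable (bergman_measure k) (\<lambda>z. (norm (f z))\<^sup>2)"
proof -
  have "integrable poincare_measure (\<lambda>z. (norm (f z))\<^sup>2 * log_weight z ^ k) \<longleftrightarrow>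
        integrable (bergman_measure k) (\<lambda>z. (norm (f z))\<^sup>2)"
    if "f holomorphic_on punctured_disk" "\<forall>z. z \<notin> punctured_disk \<longrightarrow> f z = 0"
  proof -
    have [measurable]: "f \<in> borel_measurable borel"
      using that by (intro holomorphic_vanishing_measurable) auto
    show ?thesis
      using integrable_poincare_iff[OF assms, of "\<lambda>z. (norm (f z))\<^sup>2"] by (simp add: mult.commute)
  qed
  thus ?thesis by (auto simp: bergman_space_def)
qed

lemma bergman_norm_square:
  assumes "k \<ge> 2" and [measurable]: "f \<in> borel_measurable borel"
  shows "(bergman_norm k f)\<^sup>2 = (\<integral>z. (norm (f z))\<^sup>2 \<partial>bergman_measure k)"
  using integral_poincare_eq[OF assms(1), of "\<lambda>z. (norm (f z))\<^sup>2"]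
  by (simp add: bergman_norm_def mult.commute)

lemma bergman_inner_eq:
  assumes "k \<ge> 2" and [measurable]: "f \<in> borel_measurable borel" "g \<in> borel_measurable borel"
  shows "bergman_inner k f g = (\<integral>z. f z * cnj (g z) \<partial>bergman_measure k)"
proof -
  have "(\<lambda>z. f z * cnj (g z)) \<in> borel_measurable borel" by measurable
  from integral_poincare_eq[OF assms(1) this] show ?thesis
    by (simp add: bergman_inner_def scaleR_conv_of_real mult_ac)
qed

lemma ennreal_bergman_norm_square:
  assumes k: "k \<ge> 2" and f: "f \<in> bergman_space k"
  shows "ennreal ((bergman_norm k f)\<^sup>2) =
           (\<integral>\<^sup>+z. ennreal ((norm (f z))\<^sup>2) * ennreal (bergman_density k z) \<partial>lborel)"
proof -
  have [measurable]: "f \<in> borel_measurable borel" using f by (rule bergman_space_measurable)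
  have "ennreal ((bergman_norm k f)\<^sup>2) = (\<integral>\<^sup>+z. ennreal ((norm (f z))\<^sup>2) \<partial>bergman_measure k)"
    using f k by (subst nn_integral_eq_integral) (auto simp: bergman_space_iff bergman_norm_square)
  also have "\<dots> = (\<integral>\<^sup>+z. ennreal ((norm (f z))\<^sup>2) * ennreal (bergman_density k z) \<partial>lborel)"
    unfolding bergman_measure_def by (subst nn_integral_density) (auto simp: mult.commute)
  finally show ?thesis .
qed

section \<open>Moments of the weight\<close>

lemma nn_integral_monomial_radial:
  "(\<integral>\<^sup>+z. ennreal (norm z ^ (2 * n)) * ennreal (bergman_density k z) * indicator (ball 0 1) z \<partial>lborel) =
     ennreal (2 * pi) * (\<integral>\<^sup>+t. ennreal (t ^ (k - 2) * exp (- (real n * t))) * indicator {0<..} t \<partial>lborel)"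
proof -
  \<comment> \<open>With t = log (1 / |z|^2) one has |z|^(2 n) = exp (- n t) and 1 / |z|^2 = exp t;
    the latter cancels the density exp (- t) of the pushforward, which leaves a Gamma integral when
    n >= 1.\<close>
  let ?g = "\<lambda>t::real. ennreal (exp (- (real n * t)) * (2 * t ^ (k - 2) * exp t))"
  have eq: "ennreal (norm z ^ (2 * n)) * ennreal (bergman_density k z) * indicator (ball 0 1) z =
        ?g (log_weight z) * indicator punctured_disk z" for z :: complex
  proof (cases "z \<in> punctured_disk")
    case True
    hence z: "z \<noteq> 0" by (auto simp: punctured_disk_def)
    have "norm z ^ (2 * n) = exp (- (real n * log_weight z))"
      using exp_of_nat_mult[of n "- log_weight z"] exp_log_weight[OF z] by (simp add: power_mult)
    moreover have "bergman_density k z = 2 * log_weight z ^ (k - 2) * exp (log_weight z)"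
      using True exp_log_weight[OF z] z by (simp add: bergman_density_def exp_minus field_simps)
    ultimately have "norm z ^ (2 * n) * bergman_density k z =
        exp (- (real n * log_weight z)) * (2 * log_weight z ^ (k - 2) * exp (log_weight z))"
      by (simp only:)
    hence "ennreal (norm z ^ (2 * n)) * ennreal (bergman_density k z) = ?g (log_weight z)"
      by (simp only: ennreal_mult[symmetric] zero_le_power norm_ge_zero bergman_density_nonneg)
    moreover have "z \<in> ball 0 1" using True by (simp add: punctured_disk_def)
    ultimately show ?thesis using True by simp
  qed (simp add: bergman_density_def)
  have "(\<integral>\<^sup>+z. ennreal (norm z ^ (2 * n)) * ennreal (bergman_density k z) * indicator (ball 0 1) z \<partial>lborel)
     = ennreal pi * (\<integral>\<^sup>+t. ?g t * ennreal (exp (- t)) * indicator {0<..} t \<partial>lborel)"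
    unfolding eq by (rule nn_integral_radial) measurable
  also have "(\<lambda>t. ?g t * ennreal (exp (- t)) * indicator {0<..} t) =
      (\<lambda>t. 2 * (ennreal (t ^ (k - 2) * exp (- (real n * t))) * indicator {0<..} t))"
  proof
    fix t :: real
    have "?g t * ennreal (exp (- t)) = ennreal (2 * (t ^ (k - 2) * exp (- (real n * t))))" if "t > 0"
      using that by (simp add: exp_minus field_simps flip: ennreal_mult)
    thus "?g t * ennreal (exp (- t)) * indicator {0<..} t =
       2 * (ennreal (t ^ (k - 2) * exp (- (real n * t))) * indicator {0<..} t)"
      by (auto simp: ennreal_mult split: split_indicator)
  qed
  also have "ennreal pi * (\<integral>\<^sup>+t. 2 * (ennreal (t ^ (k - 2) * exp (- (real n * t))) * indicator {0<..} t) \<partial>lborel) =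
     ennreal (2 * pi) * (\<integral>\<^sup>+t. ennreal (t ^ (k - 2) * exp (- (real n * t))) * indicator {0<..} t \<partial>lborel)"
    by (subst nn_integral_cmult) (auto simp: ennreal_mult mult_ac)
  finally show ?thesis .
qed

lemma nn_integral_power_times_exp_scaled:
  assumes "a > 0"
  shows "(\<integral>\<^sup>+t. ennreal (t ^ j * exp (- (a * t))) * indicator {0<..} t \<partial>lborel) = ennreal (fact j / a ^ Suc j)"
proof -
  let ?I = "\<integral>\<^sup>+t. ennreal (t ^ j * exp (- (a * t))) * indicator {0<..} t \<partial>lborel"
  have "ennreal (fact j) = (\<integral>\<^sup>+x. ennreal (x ^ j * exp (- x)) * indicator {0..} x \<partial>lborel)"
    by (subst nn_intergal_power_times_exp_Ici) simp
  also have "\<dots> = (\<integral>\<^sup>+x. ennreal (x ^ j * exp (- x)) * indicator {0<..} x \<partial>lborel)"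
  proof (rule nn_integral_cong_AE)
    show "AE x in lborel. ennreal (x ^ j * exp (- x)) * indicator {0..} x =
            ennreal (x ^ j * exp (- x)) * indicator {0<..} x"
      using AE_lborel_singleton[of "0::real"] by eventually_elim (auto split: split_indicator)
  qed
  also have "\<dots> = ennreal a * (\<integral>\<^sup>+x. ennreal ((a * x) ^ j * exp (- (a * x))) * indicator {0<..} (a * x) \<partial>lborel)"
    using assms by (subst nn_integral_real_affine[where c = a and t = 0]) auto
  also have "(\<integral>\<^sup>+x. ennreal ((a * x) ^ j * exp (- (a * x))) * indicator {0<..} (a * x) \<partial>lborel) = ennreal (a ^ j) * ?I"
    using assms
    by (subst nn_integral_cmult[symmetric])
       (auto intro!: nn_integral_cong simp: power_mult_distrib zero_less_mult_iff mult.assoc ennreal_mult split: split_indicator)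
  finally have *: "ennreal (fact j) = ennreal (a ^ Suc j) * ?I"
    using assms by (simp add: ennreal_mult mult.assoc)
  have "?I = ennreal (1 / a ^ Suc j) * (ennreal (a ^ Suc j) * ?I)"
    using assms by (simp add: mult.assoc[symmetric] flip: ennreal_mult)
  also have "\<dots> = ennreal (1 / a ^ Suc j * fact j)"
    unfolding *[symmetric] using assms by (intro ennreal_mult[symmetric]) auto
  also have "1 / a ^ Suc j * fact j = fact j / a ^ Suc j" by simp
  finally show ?thesis .
qed

lemma nn_integral_monomial:
  assumes "k \<ge> 2" "n \<ge> 1"
  shows "(\<integral>\<^sup>+z. ennreal (norm z ^ (2 * n)) * ennreal (bergman_density k z) * indicator (ball 0 1) z \<partial>lborel) =
     ennreal (monomial_norm2 k n)"
proof -
  have "Suc (k - 2) = k - 1" using assms by simp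
  thus ?thesis
    unfolding nn_integral_monomial_radial monomial_norm2_def using assms
    by (subst nn_integral_power_times_exp_scaled) (auto simp flip: ennreal_mult)
qed

text \<open>The integral reduces to that of t^(k - 2) over the positive half-line. It dominates the
  integrals damped by exp (- t / m), whose values (k - 2)! m^(k - 1) are at least m.\<close>

lemma nn_integral_monomial_0:
  assumes "k \<ge> 2"
  shows "(\<integral>\<^sup>+z. ennreal (bergman_density k z) * indicator (ball 0 1) z \<partial>lborel) = \<infinity>"
proof -
  let ?I = "\<integral>\<^sup>+t. ennreal (t ^ (k - 2) * exp (- (real 0 * t))) * indicator {0<..} t \<partial>lborel"
  have "of_nat m \<le> ?I" for m
  proof (cases "m = 0")
    case False
    define a where "a = 1 / real m"
    have a: "a > 0" using False by (simp add: a_def)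
    have "real m ^ 1 \<le> real m ^ Suc (k - 2)"
      using False by (intro power_increasing) auto
    also have "\<dots> \<le> fact (k - 2) * real m ^ Suc (k - 2)"
      using mult_right_mono[OF fact_ge_1[of "k - 2"], of "real m ^ Suc (k - 2)"] by simp
    also have "\<dots> = fact (k - 2) / a ^ Suc (k - 2)"
      by (simp add: a_def field_simps)
    finally have "ennreal (real m) \<le> ennreal (fact (k - 2) / a ^ Suc (k - 2))"
      by (intro ennreal_leI) simp
    also have "\<dots> = (\<integral>\<^sup>+t. ennreal (t ^ (k - 2) * exp (- (a * t))) * indicator {0<..} t \<partial>lborel)"
      using a by (rule nn_integral_power_times_exp_scaled[symmetric])
    also have "\<dots> \<le> ?I"
      using a by (intro nn_integral_mono) (auto intro!: ennreal_leI mult_left_le split: split_indicator)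
    finally show ?thesis by (simp add: ennreal_of_nat_eq_real_of_nat)
  qed auto
  hence "?I = \<infinity>"
    by (metis ennreal_Ex_less_of_nat infinity_ennreal_def leD top.not_eq_extremum)
  thus ?thesis using nn_integral_monomial_radial[of 0 k] by (simp add: ennreal_mult_top)
qed

lemma bergman_norm_nonneg: "0 \<le> bergman_norm k f"
  unfolding bergman_norm_def
proof (intro real_sqrt_ge_zero Bochner_Integration.integral_nonneg)
  fix z assume "z \<in> space poincare_measure"
  hence "z \<in> punctured_disk" by (simp add: poincare_measure_def space_restrict_space)
  thus "0 \<le> (norm (f z))\<^sup>2 * log_weight z ^ k" using log_weight_pos[of z] by simp
qed

section \<open>Power series expansion of functions in the Bergman space\<close>

text \<open>In the expansion about the centre with weight 1, the term n = 0 is |f z0|^2 times the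
  area, and the remaining terms are nonnegative. Translation invariance moves the disk to the
  origin.\<close>

lemma norm_square_le_nn_integral_ball:
  assumes "f holomorphic_on ball z0 R" "R > 0" and [measurable]: "f \<in> borel_measurable borel"
  shows "ennreal ((norm (f z0))\<^sup>2 * (pi * R\<^sup>2)) \<le> (\<integral>\<^sup>+z. ennreal ((norm (f z))\<^sup>2) * indicator (ball z0 R) z \<partial>lborel)"
proof -
  define c where "c n = (deriv ^^ n) f z0 / fact n" for n
  have sums: "(\<lambda>n. c n * u ^ n) sums f (z0 + u)" if "norm u < R" for u
    using holomorphic_power_series[OF assms(1), of "z0 + u"] that by (simp add: c_def dist_norm)
  have "ennreal ((norm (f z0))\<^sup>2 * (pi * R\<^sup>2)) = ennreal ((norm (c 0))\<^sup>2) * emeasure lborel (ball (0::complex) R)"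
    using \<open>R > 0\<close> by (simp add: c_def emeasure_ball unit_ball_vol_2 ennreal_mult)
  also have "\<dots> = (\<Sum>n\<in>{0}. ennreal ((norm (c n))\<^sup>2) * (\<integral>\<^sup>+z. ennreal (norm z ^ (2 * n)) * 1 * indicator (ball 0 R) (z::complex) \<partial>lborel))"
    by simp
  also have "\<dots> \<le> (\<Sum>n. ennreal ((norm (c n))\<^sup>2) * (\<integral>\<^sup>+z. ennreal (norm z ^ (2 * n)) * 1 * indicator (ball 0 R) (z::complex) \<partial>lborel))"
    by (intro sum_le_suminf summableI) auto
  also have "\<dots> = (\<integral>\<^sup>+u. ennreal ((norm (f (z0 + u)))\<^sup>2) * 1 * indicator (ball 0 R) u \<partial>lborel)"
    by (rule nn_integral_power_series_ball[symmetric]) (use sums in auto)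
  also have "\<dots> = (\<integral>\<^sup>+u. ennreal ((norm (f (z0 + u)))\<^sup>2) * indicator (ball z0 R) (z0 + u) \<partial>lborel)"
    by (intro nn_integral_cong) (auto simp: dist_norm split: split_indicator)
  also have "\<dots> = (\<integral>\<^sup>+z. ennreal ((norm (f z))\<^sup>2) * indicator (ball z0 R) z \<partial>distr lborel borel ((+) z0))"
    by (subst nn_integral_distr) auto
  finally show ?thesis by (simp only: lborel_distr_plus)
qed

text \<open>On the disk of radius |z0| / 2 about z0 the density is at least a constant times 1 /
  |z0|^2, while the area is proportional to |z0|^2. These factors cancel in the sub-mean-value
  inequality, so the bound does not depend on z0.\<close>

lemma bergman_space_bounded_near_0:
  assumes k: "k \<ge> 2" and f: "f \<in> bergman_space k"
  shows "\<exists>C. \<forall>z. z \<noteq> 0 \<and> norm z \<le> 1 / 2 \<longrightarrow> norm (f z) \<le> C"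
proof -
  define N where "N = (bergman_norm k f)\<^sup>2"
  \<comment> \<open>The disks used below stay inside |z| < 3 / 4, and \<open>l\<close> is the value
    of \<open>log_weight\<close> on the circle of that radius.\<close>
  define l where "l = - 2 * ln (3 / 4 :: real)"
  have l: "l > 0" by (simp add: l_def)
  define C where "C = 9 * N / (2 * pi * l ^ (k - 2))"
  have [measurable]: "f \<in> borel_measurable borel" using f by (rule bergman_space_measurable)
  have "(norm (f z0))\<^sup>2 \<le> C" if z0: "z0 \<noteq> 0" "norm z0 \<le> 1 / 2" for z0
  proof -
    define R where "R = norm z0 / 2"
    have R: "R > 0" using z0 by (simp add: R_def)
    have ball: "norm z < 3 / 2 * norm z0 \<and> z \<noteq> 0 \<and> norm z < 1" if "z \<in> ball z0 R" for z
    proof -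
      have "norm (z - z0) < norm z0 / 2" using that by (simp add: R_def dist_norm norm_minus_commute)
      moreover have "norm z \<le> norm (z - z0) + norm z0" "norm z0 \<le> norm (z - z0) + norm z"
        using norm_triangle_ineq[of "z - z0" z0] norm_triangle_ineq[of "z0 - z" z]
        by (simp_all add: norm_minus_commute)
      ultimately show ?thesis using z0 by auto
    qed
    have sub: "ball z0 R \<subseteq> punctured_disk"
    proof
      fix z assume "z \<in> ball z0 R"
      from ball[OF this] show "z \<in> punctured_disk" by (simp add: punctured_disk_def)
    qed
    \<comment> \<open>The constant comes from \<open>log_weight z\<close> >= l and |z| < 3 |z0| / 2.
      The identity A pi R^2 = 2 pi l^(k - 2) / 9 explains the choice of \<open>C\<close>.\<close>
    define A where "A = 8 * l ^ (k - 2) / (9 * (norm z0)\<^sup>2)"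
    have A: "A > 0" using l z0 by (simp add: A_def)
    have dens: "A \<le> bergman_density k z" if "z \<in> ball z0 R" for z
    proof -
      have z: "norm z < 3 / 2 * norm z0" "z \<noteq> 0" using ball[OF that] by auto
      have "ln (norm z) \<le> ln (3 / 4)"
        using z z0 by (subst ln_le_cancel_iff) auto
      hence "l ^ (k - 2) \<le> log_weight z ^ (k - 2)"
        using l z by (intro power_mono) (auto simp: l_def log_weight_eq)
      moreover have "(norm z)\<^sup>2 \<le> (3 / 2 * norm z0)\<^sup>2"
        using z by (intro power_mono) auto
      ultimately have "2 * l ^ (k - 2) / (3 / 2 * norm z0)\<^sup>2 \<le> 2 * log_weight z ^ (k - 2) / (norm z)\<^sup>2"
        using l z z0 log_weight_pos[of z] sub that by (intro frac_le) auto
      thus ?thesis using sub that z0 by (auto simp: bergman_density_def A_def field_simps)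
    qed
    have "f holomorphic_on ball z0 R"
      using f sub by (auto simp: bergman_space_def intro: holomorphic_on_subset)
    hence "ennreal ((norm (f z0))\<^sup>2 * (pi * R\<^sup>2)) \<le> (\<integral>\<^sup>+z. ennreal ((norm (f z))\<^sup>2) * indicator (ball z0 R) z \<partial>lborel)"
      by (rule norm_square_le_nn_integral_ball) (use R in auto)
    hence "ennreal A * ennreal ((norm (f z0))\<^sup>2 * (pi * R\<^sup>2)) \<le>
             ennreal A * (\<integral>\<^sup>+z. ennreal ((norm (f z))\<^sup>2) * indicator (ball z0 R) z \<partial>lborel)"
      by (intro mult_left_mono) auto
    also have "\<dots> = (\<integral>\<^sup>+z. ennreal A * (ennreal ((norm (f z))\<^sup>2) * indicator (ball z0 R) z) \<partial>lborel)"
      by (rule nn_integral_cmult[symmetric]) measurable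
    also have "\<dots> \<le> (\<integral>\<^sup>+z. ennreal ((norm (f z))\<^sup>2) * ennreal (bergman_density k z) \<partial>lborel)"
      using dens by (intro nn_integral_mono)
        (auto split: split_indicator simp: mult.commute intro!: mult_right_mono ennreal_leI)
    also have "\<dots> = ennreal N"
      unfolding N_def using ennreal_bergman_norm_square[OF k f] by simp
    finally have "A * ((norm (f z0))\<^sup>2 * (pi * R\<^sup>2)) \<le> N"
      using A by (subst (asm) ennreal_mult[symmetric]) (auto simp: N_def)
    moreover have "A * ((norm (f z0))\<^sup>2 * (pi * R\<^sup>2)) = (norm (f z0))\<^sup>2 * (2 * pi * l ^ (k - 2) / 9)"
      using z0 by (simp add: A_def R_def power_divide field_simps)
    ultimately have "(norm (f z0))\<^sup>2 * (2 * pi * l ^ (k - 2) / 9) \<le> N" by (simp only:)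
    thus ?thesis using l by (simp add: C_def field_simps)
  qed
  hence "norm (f z0) \<le> sqrt C" if "z0 \<noteq> 0" "norm z0 \<le> 1 / 2" for z0
    using that real_le_rsqrt by blast
  thus ?thesis by blast
qed

text \<open>Boundedness makes the singularity at 0 removable. The extension vanishes at 0, since a
  nonzero constant coefficient would contribute an infinite term to the finite norm; this matches
  the convention \<open>f 0 = 0\<close>, so the series represents \<open>f\<close> at the puncture
  as well.\<close>

lemma bergman_space_power_series:
  assumes k: "k \<ge> 2" and f: "f \<in> bergman_space k"
  obtains c where "\<And>z. norm z < 1 \<Longrightarrow> (\<lambda>n. c n * z ^ n) sums f z"
proof -
  have D: "punctured_disk = ball 0 1 - {0}"
    by (auto simp: punctured_disk_def)
  obtain C where C: "\<And>z. z \<noteq> 0 \<Longrightarrow> norm z \<le> 1 / 2 \<Longrightarrow> norm (f z) \<le> C"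
    using bergman_space_bounded_near_0[OF k f] by blast
  have "eventually (\<lambda>z. norm (f z) \<le> C) (at 0)"
    using C by (auto simp: eventually_at intro!: exI[of _ "1 / 2"])
  moreover have "f holomorphic_on ball 0 1 - {0}"
    using f D by (simp add: bergman_space_def)
  ultimately obtain g where g: "g holomorphic_on ball 0 1" "\<And>z. z \<in> ball 0 1 - {0} \<Longrightarrow> g z = f z"
    using holomorphic_on_extend_bounded[of f "ball 0 1" 0] by auto
  define c where "c n = (deriv ^^ n) g 0 / fact n" for n
  have sums: "(\<lambda>n. c n * z ^ n) sums g z" if "norm z < 1" for z
    using holomorphic_power_series[OF g(1), of z] that by (simp add: c_def)
  have "ennreal ((norm (c 0))\<^sup>2) * \<infinity> =
      (\<Sum>n\<in>{0}. ennreal ((norm (c n))\<^sup>2) * (\<integral>\<^sup>+z. ennreal (norm z ^ (2 * n)) * ennreal (bergman_density k z) * indicator (ball 0 1) (z::complex) \<partial>lborel))"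
    using nn_integral_monomial_0[OF k] by simp
  also have "\<dots> \<le> (\<Sum>n. ennreal ((norm (c n))\<^sup>2) * (\<integral>\<^sup>+z. ennreal (norm z ^ (2 * n)) * ennreal (bergman_density k z) * indicator (ball 0 1) (z::complex) \<partial>lborel))"
    by (intro sum_le_suminf summableI) auto
  also have "\<dots> = (\<integral>\<^sup>+z. ennreal ((norm (g z))\<^sup>2) * ennreal (bergman_density k z) * indicator (ball 0 1) z \<partial>lborel)"
    by (rule nn_integral_power_series_ball[symmetric]) (use sums bergman_density_rotate in auto)
  also have "\<dots> = (\<integral>\<^sup>+z. ennreal ((norm (f z))\<^sup>2) * ennreal (bergman_density k z) \<partial>lborel)"
    using g(2) by (intro nn_integral_cong) (auto simp: bergman_density_def D split: split_indicator)
  also have "\<dots> < \<infinity>"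
    using ennreal_bergman_norm_square[OF k f] by (metis ennreal_less_top infinity_ennreal_def)
  \<comment> \<open>In \<open>ennreal\<close> a positive number times infinity is infinite, so
    finiteness forces the coefficient to vanish.\<close>
  finally have "c 0 = 0"
    by (auto simp: ennreal_mult_top split: if_splits)
  moreover have "c 0 = g 0" using sums[of 0] powser_sums_zero_iff[of c "g 0"] by simp
  moreover have "f 0 = 0" using f by (simp add: bergman_space_def D)
  ultimately have "f z = g z" if "norm z < 1" for z
    using g(2)[of z] that by (cases "z = 0") auto
  thus ?thesis using sums by (intro that) simp
qed

lemma bergman_power_series_0:
  assumes "f \<in> bergman_space k" "\<And>z. norm z < 1 \<Longrightarrow> (\<lambda>n. c n * z ^ n) sums f z"
  shows "c 0 = 0"
  using assms(1) assms(2)[of 0] powser_sums_zero_iff[of c "f 0"]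
  by (simp add: bergman_space_def punctured_disk_def)

text \<open>This is the power series identity with the Bergman weight. At n = 0 the true moment is
  infinite whereas \<open>monomial_norm2\<close> is 0; the two terms agree because
  \<open>c 0 = 0\<close> and 0 times infinity is 0 in \<open>ennreal\<close>.\<close>

lemma bergman_norm_power_series:
  assumes k: "k \<ge> 2" and f: "f \<in> bergman_space k"
    and c: "\<And>z. norm z < 1 \<Longrightarrow> (\<lambda>n. c n * z ^ n) sums f z"
  shows "(\<lambda>n. (norm (c n))\<^sup>2 * monomial_norm2 k n) sums (bergman_norm k f)\<^sup>2"
proof -
  have c0: "c 0 = 0" by (rule bergman_power_series_0[OF f c])
  have "ennreal ((bergman_norm k f)\<^sup>2) =
     (\<integral>\<^sup>+z. ennreal ((norm (f z))\<^sup>2) * ennreal (bergman_density k z) \<partial>lborel)"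
    by (rule ennreal_bergman_norm_square[OF k f])
  also have "\<dots> = (\<integral>\<^sup>+z. ennreal ((norm (f z))\<^sup>2) * ennreal (bergman_density k z) * indicator (ball 0 1) z \<partial>lborel)"
    by (intro nn_integral_cong) (auto simp: bergman_density_def punctured_disk_def split: split_indicator)
  also have "\<dots> = (\<Sum>n. ennreal ((norm (c n))\<^sup>2) * (\<integral>\<^sup>+z. ennreal (norm z ^ (2 * n)) * ennreal (bergman_density k z) * indicator (ball 0 1) (z::complex) \<partial>lborel))"
    by (rule nn_integral_power_series_ball) (use c bergman_density_rotate in auto)
  also have "\<dots> = (\<Sum>n. ennreal ((norm (c n))\<^sup>2 * monomial_norm2 k n))"
  proof (intro arg_cong[where f = suminf] ext)
    fix n
    show "ennreal ((norm (c n))\<^sup>2) * (\<integral>\<^sup>+z. ennreal (norm z ^ (2 * n)) * ennreal (bergman_density k z) * indicator (ball 0 1) (z::complex) \<partial>lborel)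
        = ennreal ((norm (c n))\<^sup>2 * monomial_norm2 k n)"
      using k c0 by (cases "n = 0") (simp_all add: nn_integral_monomial ennreal_mult)
  qed
  finally have eq: "(\<Sum>n. ennreal ((norm (c n))\<^sup>2 * monomial_norm2 k n)) = ennreal ((bergman_norm k f)\<^sup>2)" ..
  have nonneg: "0 \<le> (norm (c n))\<^sup>2 * monomial_norm2 k n" for n
    by simp
  have summ: "summable (\<lambda>n. (norm (c n))\<^sup>2 * monomial_norm2 k n)"
    by (rule summable_suminf_not_top[OF nonneg]) (simp add: eq)
  have "ennreal (\<Sum>n. (norm (c n))\<^sup>2 * monomial_norm2 k n) = ennreal ((bergman_norm k f)\<^sup>2)"
    using suminf_ennreal2[OF nonneg summ] eq by simp
  hence "(\<Sum>n. (norm (c n))\<^sup>2 * monomial_norm2 k n) = (bergman_norm k f)\<^sup>2"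
    by (subst (asm) ennreal_inj) (auto intro!: suminf_nonneg summ nonneg)
  thus ?thesis using summ by (simp add: sums_iff)
qed

section \<open>The Hilbert space structure\<close>

lemma norm_add_square_le:
  fixes x y :: complex
  shows "(norm (x + y))\<^sup>2 \<le> 2 * (norm x)\<^sup>2 + 2 * (norm y)\<^sup>2"
proof -
  have "(norm (x + y))\<^sup>2 \<le> (norm x + norm y)\<^sup>2"
    by (intro power_mono norm_triangle_ineq) auto
  also have "\<dots> \<le> 2 * (norm x)\<^sup>2 + 2 * (norm y)\<^sup>2"
    using zero_le_power2[of "norm x - norm y"] by (simp add: power2_eq_square algebra_simps)
  finally show ?thesis .
qed

lemma bergman_space_lincomb:
  assumes k: "k \<ge> 2" and f: "f \<in> bergman_space k" and g: "g \<in> bergman_space k"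
  shows "(\<lambda>z. a * f z + b * g z) \<in> bergman_space k"
proof -
  have [measurable]: "f \<in> borel_measurable borel" "g \<in> borel_measurable borel"
    using f g by (auto intro: bergman_space_measurable)
  have "integrable (bergman_measure k) (\<lambda>z. (norm (a * f z + b * g z))\<^sup>2)"
  proof (rule Bochner_Integration.integrable_bound)
    show "integrable (bergman_measure k) (\<lambda>z. 2 * ((norm a)\<^sup>2 * (norm (f z))\<^sup>2) + 2 * ((norm b)\<^sup>2 * (norm (g z))\<^sup>2))"
      using f g k by (simp add: bergman_space_iff)
    show "AE z in bergman_measure k. norm ((norm (a * f z + b * g z))\<^sup>2) \<le>
            norm (2 * ((norm a)\<^sup>2 * (norm (f z))\<^sup>2) + 2 * ((norm b)\<^sup>2 * (norm (g z))\<^sup>2))"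
      using norm_add_square_le[of "a * f _" "b * g _"]
      by (intro AE_I2) (simp add: norm_mult power_mult_distrib)
  qed measurable
  thus ?thesis using f g k
    by (auto simp: bergman_space_iff intro!: holomorphic_intros)
qed

lemma bergman_space_sum:
  assumes k: "k \<ge> 2" and "finite F" "F \<subseteq> bergman_space k"
  shows "(\<lambda>z. \<Sum>b\<in>F. c b * b z) \<in> bergman_space k"
  using assms(2,3)
proof (induction F rule: finite_induct)
  case empty
  show ?case using k by (simp add: bergman_space_iff)
next
  case (insert b F)
  hence "(\<lambda>z. c b * b z + 1 * (\<Sum>b\<in>F. c b * b z)) \<in> bergman_space k"
    by (intro bergman_space_lincomb[OF k]) auto
  thus ?case using insert by simp
qed

lemma integrable_bergman_inner:
  assumes k: "k \<ge> 2" and f: "f \<in> bergman_space k" and g: "g \<in> bergman_space k"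
  shows "integrable (bergman_measure k) (\<lambda>z. f z * cnj (g z))"
proof (rule Bochner_Integration.integrable_bound)
  show "integrable (bergman_measure k) (\<lambda>z. (norm (f z))\<^sup>2 + (norm (g z))\<^sup>2)"
    using f g k by (simp add: bergman_space_iff)
  show "AE z in bergman_measure k. norm (f z * cnj (g z)) \<le> norm ((norm (f z))\<^sup>2 + (norm (g z))\<^sup>2)"
  proof (intro AE_I2)
    fix z
    have "norm (f z) * norm (g z) \<le> (norm (f z))\<^sup>2 + (norm (g z))\<^sup>2"
      using sum_squares_bound[of "norm (f z)" "norm (g z)"] mult_nonneg_nonneg[OF norm_ge_zero[of "f z"] norm_ge_zero[of "g z"]]
      by linarith
    thus "norm (f z * cnj (g z)) \<le> norm ((norm (f z))\<^sup>2 + (norm (g z))\<^sup>2)"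
      by (simp add: norm_mult)
  qed
  have [measurable]: "f \<in> borel_measurable borel" "g \<in> borel_measurable borel"
    using f g by (auto intro: bergman_space_measurable)
  show "(\<lambda>z. f z * cnj (g z)) \<in> borel_measurable (bergman_measure k)"
    by measurable
qed

lemma bergman_inner_self:
  assumes k: "k \<ge> 2" and f: "f \<in> bergman_space k"
  shows "bergman_inner k f f = of_real ((bergman_norm k f)\<^sup>2)"
  using f k
  by (simp add: bergman_inner_eq bergman_norm_square bergman_space_measurable
           flip: integral_complex_of_real complex_norm_square)

text \<open>Pythagoras: orthonormality removes the off-diagonal terms of the expanded inner
  product.\<close>

lemma bergman_norm_sum_square:
  assumes k: "k \<ge> 2" and F: "finite F" "F \<subseteq> bergman_space k"
    and orth: "\<And>f g. f \<in> F \<Longrightarrow> g \<in> F \<Longrightarrow> bergman_inner k f g = (if f = g then 1 else 0)"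
  shows "(bergman_norm k (\<lambda>z. \<Sum>b\<in>F. c b * b z))\<^sup>2 = (\<Sum>b\<in>F. (norm (c b))\<^sup>2)"
proof -
  let ?s = "\<lambda>z. \<Sum>b\<in>F. c b * b z"
  have int: "integrable (bergman_measure k) (\<lambda>z. c f * cnj (c g) * (f z * cnj (g z)))"
    if "f \<in> F" "g \<in> F" for f g
    using that F(2) by (intro integrable_mult_right integrable_bergman_inner[OF k]) auto
  have "of_real ((bergman_norm k ?s)\<^sup>2) = bergman_inner k ?s ?s"
    using bergman_inner_self[OF k bergman_space_sum[OF k F]] by simp
  also have "\<dots> = (\<integral>z. ?s z * cnj (?s z) \<partial>bergman_measure k)"
    by (intro bergman_inner_eq k bergman_space_measurable[OF bergman_space_sum[OF k F]])
  also have "\<dots> = (\<integral>z. (\<Sum>f\<in>F. \<Sum>g\<in>F. c f * cnj (c g) * (f z * cnj (g z))) \<partial>bergman_measure k)"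
    by (simp add: cnj_sum sum_product mult_ac)
  also have "\<dots> = (\<Sum>f\<in>F. (\<integral>z. (\<Sum>g\<in>F. c f * cnj (c g) * (f z * cnj (g z))) \<partial>bergman_measure k))"
    by (rule Bochner_Integration.integral_sum, rule Bochner_Integration.integrable_sum, rule int)
  also have "\<dots> = (\<Sum>f\<in>F. \<Sum>g\<in>F. (\<integral>z. c f * cnj (c g) * (f z * cnj (g z)) \<partial>bergman_measure k))"
    by (rule sum.cong[OF refl], rule Bochner_Integration.integral_sum, rule int)
  also have "\<dots> = (\<Sum>f\<in>F. \<Sum>g\<in>F. if f = g then complex_of_real ((norm (c f))\<^sup>2) else 0)"
  proof (intro sum.cong refl)
    fix f g assume fg: "f \<in> F" "g \<in> F"
    have "(\<integral>z. c f * cnj (c g) * (f z * cnj (g z)) \<partial>bergman_measure k) = c f * cnj (c g) * bergman_inner k f g"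
      using fg F(2) by (subst bergman_inner_eq[OF k]) (auto intro: bergman_space_measurable)
    also have "\<dots> = (if f = g then complex_of_real ((norm (c f))\<^sup>2) else 0)"
      using orth[OF fg] complex_norm_square[of "c f"] by (cases "f = g") simp_all
    finally show "(\<integral>z. c f * cnj (c g) * (f z * cnj (g z)) \<partial>bergman_measure k) = \<dots>" .
  qed
  also have "\<dots> = of_real (\<Sum>b\<in>F. (norm (c b))\<^sup>2)"
    using F(1) by simp
  finally show ?thesis by (simp only: of_real_eq_iff)
qed

text \<open>A squared substitute for the triangle inequality, obtained by integrating a pointwise
  estimate. If the norm of \<open>g\<close> is at most d, the second summand is at most d^2 + d, so
  small perturbations change the norm little.\<close>

lemma bergman_norm_add_square_le:
  assumes k: "k \<ge> 2" and f: "f \<in> bergman_space k" and g: "g \<in> bergman_space k" and d: "d > 0"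
  shows "(bergman_norm k (\<lambda>z. f z + g z))\<^sup>2 \<le> (1 + d) * (bergman_norm k f)\<^sup>2 + (1 + 1 / d) * (bergman_norm k g)\<^sup>2"
proof -
  have fg: "(\<lambda>z. f z + g z) \<in> bergman_space k"
    using bergman_space_lincomb[OF k f g, of 1 1] by simp
  have int: "integrable (bergman_measure k) (\<lambda>z. (norm (h z))\<^sup>2)" if "h \<in> bergman_space k" for h
    using that k by (simp add: bergman_space_iff)
  have "(\<integral>z. (norm (f z + g z))\<^sup>2 \<partial>bergman_measure k) \<le>
        (\<integral>z. (1 + d) * (norm (f z))\<^sup>2 + (1 + 1 / d) * (norm (g z))\<^sup>2 \<partial>bergman_measure k)"
  proof (rule integral_mono)
    fix z
    define x y where "x = norm (f z)" and "y = norm (g z)"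
    \<comment> \<open>This is (d x - y)^2 >= 0 divided by d.\<close>
    have "2 * (x * y) \<le> d * x\<^sup>2 + y\<^sup>2 / d"
      using d zero_le_power2[of "d * x - y"] by (simp add: field_simps power2_eq_square)
    hence "(x + y)\<^sup>2 \<le> (1 + d) * x\<^sup>2 + (1 + 1 / d) * y\<^sup>2"
      by (simp add: power2_sum algebra_simps)
    moreover have "(norm (f z + g z))\<^sup>2 \<le> (x + y)\<^sup>2"
      unfolding x_def y_def by (intro power_mono norm_triangle_ineq) auto
    ultimately show "(norm (f z + g z))\<^sup>2 \<le> (1 + d) * (norm (f z))\<^sup>2 + (1 + 1 / d) * (norm (g z))\<^sup>2"
      unfolding x_def y_def by linarith
  qed (use int[OF f] int[OF g] int[OF fg] in auto)
  also have "\<dots> = (1 + d) * (\<integral>z. (norm (f z))\<^sup>2 \<partial>bergman_measure k) + (1 + 1 / d) * (\<integral>z. (norm (g z))\<^sup>2 \<partial>bergman_measure k)"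
    using int[OF f] int[OF g] by simp
  finally show ?thesis
    using k f g fg by (simp add: bergman_norm_square bergman_space_measurable)
qed

section \<open>Asymptotics of the sum of n ^ j * x ^ n\<close>

text \<open>The binomial series with exponent - (j + 1) at - x; the sign of the generalised binomial
  coefficient cancels that of (- x)^n.\<close>

lemma sums_negative_binomial:
  fixes x :: real
  assumes "\<bar>x\<bar> < 1"
  shows "(\<lambda>n. real ((n + j) choose j) * x ^ n) sums (1 / (1 - x) ^ Suc j)"
proof -
  have "(\<lambda>n. ((- real (Suc j)) gchoose n) * (- x) ^ n) sums (1 + (- x)) powr (- real (Suc j))"
    by (rule gen_binomial_real) (use assms in simp)
  also have "(\<lambda>n. ((- real (Suc j)) gchoose n) * (- x) ^ n) = (\<lambda>n. real ((n + j) choose j) * x ^ n)"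
  proof
    fix n
    have "(- real (Suc j)) gchoose n = (- 1) ^ n * (real (n + j) gchoose n)"
      by (subst gbinomial_minus) (simp add: algebra_simps)
    also have "real (n + j) gchoose n = real ((n + j) choose j)"
      using binomial_symmetric[of j "n + j"] binomial_gbinomial[of "n + j" n, where ?'a = real] by simp
    finally show "((- real (Suc j)) gchoose n) * (- x) ^ n = real ((n + j) choose j) * x ^ n"
      by (simp add: power_mult_distrib[symmetric] mult_ac flip: mult.assoc)
  qed
  also have "(1 + (- x)) powr (- real (Suc j)) = 1 / (1 - x) ^ Suc j"
    using assms by (subst powr_minus) (simp add: powr_realpow divide_inverse del: of_nat_Suc power_Suc)
  finally show ?thesis .
qed

text \<open>The right-hand side is the product (n + 1) ... (n + j).\<close>

lemma power_le_fact_times_binomial: "n ^ j \<le> fact j * ((n + j) choose j)"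
proof (induction j)
  case (Suc j)
  have "n ^ Suc j \<le> n * (fact j * ((n + j) choose j))"
    using Suc by simp
  also have "\<dots> \<le> fact j * (Suc (n + j) * ((n + j) choose j))"
    by (simp add: algebra_simps)
  also have "\<dots> = fact (Suc j) * ((n + Suc j) choose Suc j)"
    using Suc_times_binomial_eq[of "n + j" j] by (simp add: algebra_simps)
  finally show ?case .
qed simp

lemma
  fixes x :: real
  assumes x: "0 \<le> x" "x < 1"
  shows summable_power_times_power: "summable (\<lambda>n. real n ^ j * x ^ n)"
    and suminf_power_times_power_le: "(\<Sum>n. real n ^ j * x ^ n) \<le> fact j / (1 - x) ^ Suc j"
    and suminf_power_times_power_ge: "fact j * x ^ j / (1 - x) ^ Suc j \<le> (\<Sum>n. real n ^ j * x ^ n)"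
proof -
  have s: "(\<lambda>n. fact j * (real ((n + j) choose j) * x ^ n)) sums (fact j * (1 / (1 - x) ^ Suc j))"
    using x by (intro sums_mult sums_negative_binomial) auto
  have le: "real n ^ j * x ^ n \<le> fact j * (real ((n + j) choose j) * x ^ n)" for n
  proof -
    have "real (n ^ j) \<le> real (fact j * ((n + j) choose j))"
      using power_le_fact_times_binomial by (rule of_nat_mono)
    hence "real n ^ j * x ^ n \<le> fact j * real ((n + j) choose j) * x ^ n"
      using x by (intro mult_right_mono) auto
    thus ?thesis by (simp only: mult.assoc)
  qed
  show summ: "summable (\<lambda>n. real n ^ j * x ^ n)"
    by (rule summable_comparison_test'[OF sums_summable[OF s], of 0]) (use le x in auto)
  show "(\<Sum>n. real n ^ j * x ^ n) \<le> fact j / (1 - x) ^ Suc j"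
    using suminf_le[OF le summ sums_summable[OF s]] sums_unique[OF s] by simp
  \<comment> \<open>For the lower bound the summation starts at index j: the shift produces the
    factor x^j, and the omitted terms are nonnegative.\<close>
  have "fact j * x ^ j / (1 - x) ^ Suc j = (\<Sum>n. x ^ j * (fact j * (real ((n + j) choose j) * x ^ n)))"
    using sums_unique[OF sums_mult[OF s, of "x ^ j"]] by (simp add: mult_ac)
  also have "\<dots> \<le> (\<Sum>n. real (n + j) ^ j * x ^ (n + j))"
  proof (rule suminf_le)
    show "summable (\<lambda>n. x ^ j * (fact j * (real ((n + j) choose j) * x ^ n)))"
      by (rule sums_summable[OF sums_mult[OF s]])
    show "summable (\<lambda>n. real (n + j) ^ j * x ^ (n + j))"
      using summ by (rule summable_ignore_initial_segment)
    fix n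
    have "real (((n + j) choose j) * fact j) \<le> real ((n + j) ^ j)"
      using binomial_fact_pow by (rule of_nat_mono)
    hence "(real ((n + j) choose j) * fact j) * x ^ (n + j) \<le> real (n + j) ^ j * x ^ (n + j)"
      using x by (intro mult_right_mono) auto
    thus "x ^ j * (fact j * (real ((n + j) choose j) * x ^ n)) \<le> real (n + j) ^ j * x ^ (n + j)"
      by (simp add: power_add mult_ac)
  qed
  also have "\<dots> \<le> (\<Sum>n. real n ^ j * x ^ n)"
    using suminf_split_initial_segment[OF summ, of j] x by (simp add: sum_nonneg)
  finally show "fact j * x ^ j / (1 - x) ^ Suc j \<le> (\<Sum>n. real n ^ j * x ^ n)" .
qed

text \<open>Both bounds are (ln (1 / x) / (1 - x))^(j + 1) times a factor tending to j!, and the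
  quotient ln (1 / x) / (1 - x) tends to 1.\<close>

lemma tendsto_ln_power_times_suminf:
  "((\<lambda>x. ln (1 / x) ^ Suc j * (\<Sum>n. real n ^ j * x ^ n)) \<longlongrightarrow> fact j) (at_left (1::real))"
proof (rule tendsto_sandwich)
  have q: "((\<lambda>x. ln (1 / x) / (1 - x)) \<longlongrightarrow> 1) (at_left (1::real))"
    by real_asymp
  have ev: "eventually (\<lambda>x::real. 0 < x \<and> x < 1) (at_left 1)"
    using eventually_at_left_real[of 0 "1::real"] by simp
  have x: "((\<lambda>x. x) \<longlongrightarrow> 1) (at_left (1::real))"
    by (rule tendsto_ident_at)
  have "((\<lambda>x. (ln (1 / x) / (1 - x)) ^ Suc j * (fact j * x ^ j)) \<longlongrightarrow> 1 ^ Suc j * (fact j * 1 ^ j)) (at_left (1::real))"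
    by (intro tendsto_intros q x)
  thus "((\<lambda>x. (ln (1 / x) / (1 - x)) ^ Suc j * (fact j * x ^ j)) \<longlongrightarrow> fact j) (at_left (1::real))"
    by simp
  have "((\<lambda>x. (ln (1 / x) / (1 - x)) ^ Suc j * fact j) \<longlongrightarrow> 1 ^ Suc j * fact j) (at_left (1::real))"
    by (intro tendsto_intros q)
  thus "((\<lambda>x. (ln (1 / x) / (1 - x)) ^ Suc j * fact j) \<longlongrightarrow> fact j) (at_left (1::real))"
    by simp
  show "eventually (\<lambda>x. (ln (1 / x) / (1 - x)) ^ Suc j * (fact j * x ^ j) \<le>
          ln (1 / x) ^ Suc j * (\<Sum>n. real n ^ j * x ^ n)) (at_left (1::real))"
    using ev
  proof eventually_elim
    case (elim x)
    hence "ln (1 / x) ^ Suc j * (fact j * x ^ j / (1 - x) ^ Suc j) \<le> ln (1 / x) ^ Suc j * (\<Sum>n. real n ^ j * x ^ n)"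
      by (intro mult_left_mono suminf_power_times_power_ge zero_le_power) auto
    thus ?case by (simp add: power_divide)
  qed
  show "eventually (\<lambda>x. ln (1 / x) ^ Suc j * (\<Sum>n. real n ^ j * x ^ n) \<le>
          (ln (1 / x) / (1 - x)) ^ Suc j * fact j) (at_left (1::real))"
    using ev
  proof eventually_elim
    case (elim x)
    hence "ln (1 / x) ^ Suc j * (\<Sum>n. real n ^ j * x ^ n) \<le> ln (1 / x) ^ Suc j * (fact j / (1 - x) ^ Suc j)"
      by (intro mult_left_mono suminf_power_times_power_le zero_le_power) auto
    thus ?case by (simp add: power_divide)
  qed
qed

section \<open>The kernel on the diagonal\<close>

text \<open>For k >= 2 and n = 0 the divisor is 0, which yields the zero function; basis elements
  come only from n >= 1, in accordance with the infinite norm of constants. The value 0 off the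
  punctured disk follows the convention of \<open>bergman_space\<close>.\<close>

definition monomial_basis :: "nat \<Rightarrow> nat \<Rightarrow> complex \<Rightarrow> complex" where
  "monomial_basis k n z = (if z \<in> punctured_disk then z ^ n / of_real (sqrt (monomial_norm2 k n)) else 0)"

lemma monomial_basis_in_bergman_space:
  assumes k: "k \<ge> 2" and n: "n \<ge> 1"
  shows "monomial_basis k n \<in> bergman_space k"
proof -
  define m where "m = monomial_norm2 k n"
  have m: "m > 0" using monomial_norm2_pos n by (simp add: m_def)
  have "(\<lambda>z. z ^ n / of_real (sqrt m)) holomorphic_on punctured_disk"
    using m by (intro holomorphic_intros) auto
  hence holo: "monomial_basis k n holomorphic_on punctured_disk"
    by (rule holomorphic_transform) (simp add: monomial_basis_def m_def)
  have vanish: "monomial_basis k n z = 0" if "z \<notin> punctured_disk" for z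
    using that by (simp add: monomial_basis_def)
  have [measurable]: "monomial_basis k n \<in> borel_measurable borel"
    using holo vanish by (rule holomorphic_vanishing_measurable)
  have "(\<integral>\<^sup>+z. ennreal ((norm (monomial_basis k n z))\<^sup>2) \<partial>bergman_measure k)
      = (\<integral>\<^sup>+z. ennreal (bergman_density k z) * ennreal ((norm (monomial_basis k n z))\<^sup>2) \<partial>lborel)"
    unfolding bergman_measure_def by (rule nn_integral_density) measurable
  also have "\<dots> = (\<integral>\<^sup>+z. ennreal (1 / m) * (ennreal (norm z ^ (2 * n)) * ennreal (bergman_density k z) * indicator (ball 0 1) z) \<partial>lborel)"
  proof (intro nn_integral_cong)
    fix z :: complex
    show "ennreal (bergman_density k z) * ennreal ((norm (monomial_basis k n z))\<^sup>2) =
       ennreal (1 / m) * (ennreal (norm z ^ (2 * n)) * ennreal (bergman_density k z) * indicator (ball 0 1) z)"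
    proof (cases "z \<in> punctured_disk")
      case True
      have "(norm (monomial_basis k n z))\<^sup>2 = 1 / m * norm z ^ (2 * n)"
        using True m by (simp add: monomial_basis_def m_def norm_divide norm_power power_divide mult.commute flip: power_mult)
      moreover have "z \<in> ball 0 1" using True by (simp add: punctured_disk_def)
      moreover have "ennreal (1 / m * norm z ^ (2 * n)) = ennreal (1 / m) * ennreal (norm z ^ (2 * n))"
        using m by (intro ennreal_mult) auto
      ultimately show ?thesis by (simp add: mult_ac)
    qed (simp add: bergman_density_def)
  qed
  also have "\<dots> = ennreal (1 / m) * ennreal m"
    unfolding m_def by (subst nn_integral_cmult) (simp_all add: nn_integral_monomial k n[simplified])
  also have "\<dots> < \<infinity>" by (simp add: ennreal_mult_less_top)
  finally have "integrable (bergman_measure k) (\<lambda>z. (norm (monomial_basis k n z))\<^sup>2)"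
    by (intro integrableI_bounded) auto
  thus ?thesis using holo vanish k by (simp add: bergman_space_iff)
qed

lemma monomial_basis_sums:
  assumes "n \<ge> 1" "norm z < 1"
  shows "(\<lambda>j. (if j = n then 1 / of_real (sqrt (monomial_norm2 k n)) else 0) * z ^ j) sums monomial_basis k n z"
proof -
  have "(\<lambda>j. (if j = n then 1 / of_real (sqrt (monomial_norm2 k n)) else 0) * z ^ j) =
        (\<lambda>j. if j = n then z ^ j / of_real (sqrt (monomial_norm2 k n)) else 0)"
    by auto
  moreover have "monomial_basis k n z = z ^ n / of_real (sqrt (monomial_norm2 k n))"
    using assms by (auto simp: monomial_basis_def punctured_disk_def)
  ultimately show ?thesis using sums_single[of n "\<lambda>j. z ^ j / of_real (sqrt (monomial_norm2 k n))"] by simp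
qed

lemma bergman_norm_monomial_basis:
  assumes k: "k \<ge> 2" and n: "n \<ge> 1"
  shows "(bergman_norm k (monomial_basis k n))\<^sup>2 = 1"
proof -
  let ?c = "\<lambda>j. if j = n then 1 / complex_of_real (sqrt (monomial_norm2 k n)) else 0"
  have "(\<lambda>j. (norm (?c j))\<^sup>2 * monomial_norm2 k j) sums (bergman_norm k (monomial_basis k n))\<^sup>2"
    by (intro bergman_norm_power_series k monomial_basis_in_bergman_space n monomial_basis_sums)
  moreover have "(\<lambda>j. (norm (?c j))\<^sup>2 * monomial_norm2 k j) = (\<lambda>j. if j = n then 1 else 0)"
    using monomial_norm2_pos[OF n, of k] by (auto simp: norm_divide power_divide)
  ultimately show ?thesis using sums_single[of n "\<lambda>_. 1::real"] sums_unique2 by metis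
qed

text \<open>For distinct indices there is a rotation under which the integrand changes sign.
  Rotation invariance of Lebesgue measure then makes the integral equal to its own negative.\<close>

lemma bergman_inner_monomial_basis:
  assumes k: "k \<ge> 2" and n: "n \<ge> 1" and m: "m \<ge> 1"
  shows "bergman_inner k (monomial_basis k n) (monomial_basis k m) = (if n = m then 1 else 0)"
proof (cases "n = m")
  case True
  thus ?thesis
    using bergman_inner_self[OF k monomial_basis_in_bergman_space[OF k n]] bergman_norm_monomial_basis[OF k n]
    by (simp del: of_real_power)
next
  case False
  let ?e = "monomial_basis k"
  have [measurable]: "?e n \<in> borel_measurable borel" "?e m \<in> borel_measurable borel"
    using monomial_basis_in_bergman_space k n m bergman_space_measurable by blast+
  \<comment> \<open>The angle is chosen so that \<zeta>^(n - m) = cis pi = -1.\<close>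
  define \<zeta> where "\<zeta> = cis (pi / (real n - real m))"
  have \<zeta>: "norm \<zeta> = 1" by (simp add: \<zeta>_def)
  have "\<zeta> ^ n * cnj (\<zeta> ^ m) = cis (real n * (pi / (real n - real m)) - real m * (pi / (real n - real m)))"
    by (simp add: \<zeta>_def Complex.DeMoivre cis_cnj cis_mult)
  also have "real n * (pi / (real n - real m)) - real m * (pi / (real n - real m)) = pi"
    unfolding left_diff_distrib[symmetric] using False by simp
  finally have \<zeta>': "\<zeta> ^ n * cnj (\<zeta> ^ m) = -1" by simp
  have rot: "?e j (\<zeta> * z) = \<zeta> ^ j * ?e j z" for j z
    using \<zeta> by (simp add: monomial_basis_def punctured_disk_def norm_mult power_mult_distrib) (use \<zeta> in auto)
  define F where "F z = bergman_density k z *\<^sub>R (?e n z * cnj (?e m z))" for z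
  have [measurable]: "F \<in> borel_measurable borel" unfolding F_def by measurable
  have rotF: "F (\<zeta> * z) = - F z" for z
  proof -
    have "F (\<zeta> * z) = (\<zeta> ^ n * cnj (\<zeta> ^ m)) * F z"
      by (simp add: F_def rot bergman_density_rotate[OF \<zeta>] scaleR_conv_of_real mult_ac)
    thus ?thesis unfolding \<zeta>' by simp
  qed
  have inner: "bergman_inner k (?e n) (?e m) = (\<integral>z. F z \<partial>lborel)"
    using k by (simp add: bergman_inner_eq bergman_measure_def integral_density F_def)
  have "(\<integral>z. F z \<partial>lborel) = (\<integral>z. F z \<partial>distr lborel borel ((*) \<zeta>))"
    by (simp only: lborel_distr_rotate[OF \<zeta>])
  also have "\<dots> = (\<integral>z. F (\<zeta> * z) \<partial>lborel)"
    by (rule integral_distr) auto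
  also have "\<dots> = - (\<integral>z. F z \<partial>lborel)"
    by (simp add: rotF)
  finally have "(\<integral>z. F z \<partial>lborel) = 0" by simp
  thus ?thesis using False inner by simp
qed

text \<open>An orthonormal basis is a set of functions here; injectivity allows passing between sums
  over indices and sums over functions.\<close>

lemma inj_on_monomial_basis:
  assumes k: "k \<ge> 2"
  shows "inj_on (monomial_basis k) {1..}"
proof (rule inj_onI)
  fix n m :: nat
  assume nm: "n \<in> {1..}" "m \<in> {1..}" "monomial_basis k n = monomial_basis k m"
  have "bergman_inner k (monomial_basis k n) (monomial_basis k m) = 1"
    using bergman_inner_monomial_basis[OF k, of n n] nm by simp
  thus "n = m"
    using bergman_inner_monomial_basis[OF k, of n m] nm by (simp split: if_splits)
qed

text \<open>Density comes from truncating the power series: the squared error is the tail of the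
  convergent series for the squared norm.\<close>

lemma bergman_orthonormal_basis_monomial:
  assumes k: "k \<ge> 2"
  shows "bergman_orthonormal_basis k (monomial_basis k ` {1..})"
  unfolding bergman_orthonormal_basis_def
proof (intro conjI ballI allI impI)
  let ?e = "monomial_basis k"
  show "?e ` {1..} \<subseteq> bergman_space k"
    using monomial_basis_in_bergman_space[OF k] by auto
  show "bergman_inner k f g = (if f = g then 1 else 0)" if "f \<in> ?e ` {1..}" "g \<in> ?e ` {1..}" for f g
    using that bergman_inner_monomial_basis[OF k] inj_on_monomial_basis[OF k]
    by (auto simp: inj_on_eq_iff)
  fix f \<epsilon> assume f: "f \<in> bergman_space k" and \<epsilon>: "\<epsilon> > (0::real)"
  obtain c where c: "\<And>z. norm z < 1 \<Longrightarrow> (\<lambda>n. c n * z ^ n) sums f z"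
    using bergman_space_power_series[OF k f] by blast
  have c0: "c 0 = 0" by (rule bergman_power_series_0[OF f c])
  define a where "a n = (norm (c n))\<^sup>2 * monomial_norm2 k n" for n
  have a: "a sums (bergman_norm k f)\<^sup>2"
    unfolding a_def by (rule bergman_norm_power_series[OF k f c])
  \<comment> \<open>Coefficients are attached to functions rather than indices, so the index is
    recovered by inverting the enumeration. The square root undoes the normalisation.\<close>
  define c' where "c' b = (let n = inv_into {1..} ?e b in c n * of_real (sqrt (monomial_norm2 k n)))" for b
  define s where "s N z = (\<Sum>b\<in>?e ` {1..N}. c' b * b z)" for N z
  have s_eq: "s N z = (\<Sum>n\<in>{1..N}. c n * z ^ n)" if "z \<in> punctured_disk" for N z
  proof -
    have "s N z = (\<Sum>n\<in>{1..N}. c' (?e n) * ?e n z)"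
      unfolding s_def by (rule sum.reindex_cong[OF inj_on_subset[OF inj_on_monomial_basis[OF k]]]) auto
    also have "\<dots> = (\<Sum>n\<in>{1..N}. c n * z ^ n)"
    proof (rule sum.cong[OF refl])
      fix n assume n: "n \<in> {1..N}"
      hence "c' (?e n) = c n * of_real (sqrt (monomial_norm2 k n))"
        unfolding c'_def by (subst inv_into_f_f[OF inj_on_monomial_basis[OF k]]) auto
      moreover have "monomial_norm2 k n > 0" using n monomial_norm2_pos by simp
      ultimately show "c' (?e n) * ?e n z = c n * z ^ n"
        using that by (simp add: monomial_basis_def)
    qed
    finally show ?thesis .
  qed
  have s_space: "s N \<in> bergman_space k" for N
    unfolding s_def by (rule bergman_space_sum[OF k]) (use monomial_basis_in_bergman_space[OF k] in auto)
  have diff_space: "(\<lambda>z. f z - s N z) \<in> bergman_space k" for N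
    using bergman_space_lincomb[OF k f s_space, of 1 "-1"] by simp
  have norm_diff: "(bergman_norm k (\<lambda>z. f z - s N z))\<^sup>2 = (bergman_norm k f)\<^sup>2 - (\<Sum>n\<in>{1..N}. a n)" for N
  proof -
    let ?d = "\<lambda>n. if n \<in> {1..N} then 0 else c n"
    have "(\<lambda>n. (norm (?d n))\<^sup>2 * monomial_norm2 k n) sums (bergman_norm k (\<lambda>z. f z - s N z))\<^sup>2"
    proof (rule bergman_norm_power_series[OF k diff_space])
      fix z :: complex assume z: "norm z < 1"
      have "(\<lambda>n. c n * z ^ n - (if n \<in> {1..N} then c n * z ^ n else 0)) sums (f z - (\<Sum>n\<in>{1..N}. c n * z ^ n))"
        by (intro sums_diff c z sums_If_finite_set) auto
      moreover have "f z - (\<Sum>n\<in>{1..N}. c n * z ^ n) = f z - s N z"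
      proof (cases "z = 0")
        \<comment> \<open>The formula \<open>s_eq\<close> holds on the punctured disk only; at 0
          both sums vanish, the power sum because its indices start at 1.\<close>
        case True
        have "s N 0 = 0" using s_space[of N] by (simp add: bergman_space_def punctured_disk_def)
        thus ?thesis using True by (simp add: sum.neutral)
      next
        case False
        thus ?thesis using z by (subst s_eq) (auto simp: punctured_disk_def)
      qed
      moreover have "(\<lambda>n. c n * z ^ n - (if n \<in> {1..N} then c n * z ^ n else 0)) = (\<lambda>n. ?d n * z ^ n)"
        by auto
      ultimately show "(\<lambda>n. ?d n * z ^ n) sums (f z - s N z)" by simp
    qed
    moreover have "(\<lambda>n. a n - (if n \<in> {1..N} then a n else 0)) sums ((bergman_norm k f)\<^sup>2 - (\<Sum>n\<in>{1..N}. a n))"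
      by (intro sums_diff a sums_If_finite_set) auto
    moreover have "(\<lambda>n. (norm (?d n))\<^sup>2 * monomial_norm2 k n) = (\<lambda>n. a n - (if n \<in> {1..N} then a n else 0))"
      by (auto simp: a_def)
    ultimately show ?thesis using sums_unique2 by metis
  qed
  have "(\<lambda>N. \<Sum>n\<in>{1..N}. a n) \<longlonglongrightarrow> (bergman_norm k f)\<^sup>2"
  proof -
    have "(\<Sum>n\<in>{1..N}. a n) = (\<Sum>n\<in>{..N}. a n)" for N
      by (rule sum.mono_neutral_left) (auto simp: a_def c0 Suc_le_eq)
    thus ?thesis using a by (simp add: sums_def_le)
  qed
  hence "(\<lambda>N. (bergman_norm k f)\<^sup>2 - (\<Sum>n\<in>{1..N}. a n)) \<longlonglongrightarrow> (bergman_norm k f)\<^sup>2 - (bergman_norm k f)\<^sup>2"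
    by (intro tendsto_intros)
  hence "eventually (\<lambda>N. (bergman_norm k f)\<^sup>2 - (\<Sum>n\<in>{1..N}. a n) < \<epsilon>\<^sup>2) sequentially"
    using \<epsilon> by (intro order_tendstoD(2)) auto
  from eventually_happens'[OF sequentially_bot this]
  obtain N where "(bergman_norm k f)\<^sup>2 - (\<Sum>n\<in>{1..N}. a n) < \<epsilon>\<^sup>2" ..
  hence "(bergman_norm k (\<lambda>z. f z - s N z))\<^sup>2 < \<epsilon>\<^sup>2"
    by (simp only: norm_diff)
  hence "bergman_norm k (\<lambda>z. f z - s N z) < \<epsilon>"
    by (rule power_less_imp_less_base) (use \<epsilon> in simp)
  thus "\<exists>F c. finite F \<and> F \<subseteq> ?e ` {1..} \<and> bergman_norm k (\<lambda>z. f z - (\<Sum>b\<in>F. c b * b z)) < \<epsilon>"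
    unfolding s_def by (intro exI[of _ "?e ` {1..N}"] exI[of _ c']) auto
qed

text \<open>For k >= 2 and z in the punctured disk this is the reproducing kernel on the diagonal,
  without the factor \<open>log_weight z ^ k\<close>, computed from the normalised monomials.
  Division by zero removes the term n = 0.\<close>

definition bergman_diagonal :: "nat \<Rightarrow> complex \<Rightarrow> real" where
  "bergman_diagonal k z = (\<Sum>n. norm z ^ (2 * n) / monomial_norm2 k n)"

lemma bergman_diagonal_terms:
  "norm z ^ (2 * n) / monomial_norm2 k n = (real n ^ (k - 1) * (norm z ^ 2) ^ n) / (2 * pi * fact (k - 2))"
  by (simp add: monomial_norm2_def power_mult)

lemma summable_bergman_diagonal:
  assumes "norm z < 1"
  shows "summable (\<lambda>n. norm z ^ (2 * n) / monomial_norm2 k n)"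
  unfolding bergman_diagonal_terms
  by (intro summable_divide summable_power_times_power) (use assms in \<open>auto simp: power_less_one_iff\<close>)

lemma bergman_diagonal_eq:
  assumes "norm z < 1"
  shows "bergman_diagonal k z = (\<Sum>n. real n ^ (k - 1) * (norm z ^ 2) ^ n) / (2 * pi * fact (k - 2))"
  unfolding bergman_diagonal_def bergman_diagonal_terms
  by (intro suminf_divide summable_power_times_power) (use assms in \<open>auto simp: power_less_one_iff\<close>)

text \<open>Cauchy-Schwarz for partial sums, with c_n z^n split as (c_n sqrt m_n) (z^n / sqrt m_n),
  followed by a passage to the limit. At n = 0 the second factor is 0 through division by zero,
  which is consistent with \<open>c 0 = 0\<close>.\<close>

lemma norm_square_le_bergman_diagonal:
  assumes k: "k \<ge> 2" and f: "f \<in> bergman_space k" and z: "norm z < 1"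
  shows "(norm (f z))\<^sup>2 \<le> (bergman_norm k f)\<^sup>2 * bergman_diagonal k z"
proof -
  obtain c where c: "\<And>z. norm z < 1 \<Longrightarrow> (\<lambda>n. c n * z ^ n) sums f z"
    using bergman_space_power_series[OF k f] by blast
  have c0: "c 0 = 0" by (rule bergman_power_series_0[OF f c])
  have a: "(\<lambda>n. (norm (c n))\<^sup>2 * monomial_norm2 k n) sums (bergman_norm k f)\<^sup>2"
    by (rule bergman_norm_power_series[OF k f c])
  have "(norm (\<Sum>n<N. c n * z ^ n))\<^sup>2 \<le> (bergman_norm k f)\<^sup>2 * bergman_diagonal k z" for N
  proof -
    define u where "u n = norm (c n) * sqrt (monomial_norm2 k n)" for n
    define v where "v n = norm z ^ n / sqrt (monomial_norm2 k n)" for n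
    have "norm (\<Sum>n<N. c n * z ^ n) \<le> (\<Sum>n<N. norm (c n * z ^ n))"
      by (rule norm_sum)
    also have "\<dots> = (\<Sum>n<N. u n * v n)"
    proof (rule sum.cong[OF refl])
      fix n
      show "norm (c n * z ^ n) = u n * v n"
        using monomial_norm2_pos[of n k] c0
        by (cases "n = 0") (auto simp: u_def v_def norm_mult norm_power)
    qed
    finally have "(norm (\<Sum>n<N. c n * z ^ n))\<^sup>2 \<le> (\<Sum>n<N. u n * v n)\<^sup>2"
      by (intro power_mono) auto
    also have "\<dots> \<le> (\<Sum>n<N. (u n)\<^sup>2) * (\<Sum>n<N. (v n)\<^sup>2)"
      by (rule Cauchy_Schwarz_ineq_sum)
    also have "(\<Sum>n<N. (u n)\<^sup>2) = (\<Sum>n<N. (norm (c n))\<^sup>2 * monomial_norm2 k n)"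
      by (simp add: u_def power_mult_distrib)
    also have "(\<Sum>n<N. (v n)\<^sup>2) = (\<Sum>n<N. norm z ^ (2 * n) / monomial_norm2 k n)"
      by (simp add: v_def power_divide mult.commute flip: power_mult)
    also have "(\<Sum>n<N. (norm (c n))\<^sup>2 * monomial_norm2 k n) * (\<Sum>n<N. norm z ^ (2 * n) / monomial_norm2 k n)
       \<le> (bergman_norm k f)\<^sup>2 * bergman_diagonal k z"
    proof (rule mult_mono)
      show "(\<Sum>n<N. (norm (c n))\<^sup>2 * monomial_norm2 k n) \<le> (bergman_norm k f)\<^sup>2"
        unfolding sums_unique[OF a] by (intro sum_le_suminf sums_summable[OF a]) auto
      show "(\<Sum>n<N. norm z ^ (2 * n) / monomial_norm2 k n) \<le> bergman_diagonal k z"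
        unfolding bergman_diagonal_def by (intro sum_le_suminf summable_bergman_diagonal z) auto
    qed (auto intro!: sum_nonneg)
    finally show ?thesis .
  qed
  moreover have "(\<lambda>N. (norm (\<Sum>n<N. c n * z ^ n))\<^sup>2) \<longlonglongrightarrow> (norm (f z))\<^sup>2"
    using c[OF z] by (auto simp: sums_def intro!: tendsto_intros)
  ultimately show ?thesis by (intro LIMSEQ_le_const2) auto
qed

section \<open>Independence of the choice of orthonormal basis\<close>

lemma finite_sum_orthonormal_le_bergman_diagonal:
  assumes k: "k \<ge> 2" and F: "finite F" "F \<subseteq> bergman_space k"
    and orth: "\<And>f g. f \<in> F \<Longrightarrow> g \<in> F \<Longrightarrow> bergman_inner k f g = (if f = g then 1 else 0)"
    and z: "norm z < 1"
  shows "(\<Sum>f\<in>F. (norm (f z))\<^sup>2) \<le> bergman_diagonal k z"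
proof -
  define T where "T = (\<Sum>f\<in>F. (norm (f z))\<^sup>2)"
  \<comment> \<open>The value of this combination at \<open>z\<close> and its squared norm are both
    T, so the pointwise bound reads T^2 <= T S with S = \<open>bergman_diagonal k z\<close>.\<close>
  let ?g = "\<lambda>w. \<Sum>b\<in>F. cnj (b z) * b w"
  have T: "T \<ge> 0" unfolding T_def by (intro sum_nonneg) auto
  have "?g z = of_real T"
    unfolding T_def of_real_sum complex_norm_square by (simp add: mult.commute)
  hence "T\<^sup>2 = (norm (?g z))\<^sup>2" by simp
  also have "\<dots> \<le> (bergman_norm k ?g)\<^sup>2 * bergman_diagonal k z"
    by (intro norm_square_le_bergman_diagonal k z bergman_space_sum F)
  also have "(bergman_norm k ?g)\<^sup>2 = T"
    using bergman_norm_sum_square[OF k F orth, of "\<lambda>b. cnj (b z)"] by (simp add: T_def)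
  finally have "T * T \<le> T * bergman_diagonal k z" by (simp add: power2_eq_square)
  moreover have "0 \<le> bergman_diagonal k z"
    unfolding bergman_diagonal_def by (intro suminf_nonneg summable_bergman_diagonal z) auto
  ultimately have "T \<le> bergman_diagonal k z"
    using T by (cases "T = 0") auto
  thus ?thesis by (simp add: T_def)
qed

lemma infsum_orthonormal_basis:
  assumes k: "k \<ge> 2" and B: "bergman_orthonormal_basis k B" and z: "z \<in> punctured_disk"
  shows "(\<Sum>\<^sub>\<infinity>f\<in>B. (norm (f z))\<^sup>2) = bergman_diagonal k z"
proof -
  from B have Bs: "B \<subseteq> bergman_space k"
    and orth: "\<And>f g. f \<in> B \<Longrightarrow> g \<in> B \<Longrightarrow> bergman_inner k f g = (if f = g then 1 else 0)"
    and dense: "\<And>f \<epsilon>. f \<in> bergman_space k \<Longrightarrow> \<epsilon> > 0 \<Longrightarrow> \<exists>F c. finite F \<and> F \<subseteq> B \<and>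
        bergman_norm k (\<lambda>z. f z - (\<Sum>b\<in>F. c b * b z)) < \<epsilon>"
    unfolding bergman_orthonormal_basis_def by blast+
  have z1: "norm z < 1" using z by (simp add: punctured_disk_def)
  define S where "S = bergman_diagonal k z"
  define T where "T = (\<Sum>\<^sub>\<infinity>f\<in>B. (norm (f z))\<^sup>2)"
  have fin: "(\<Sum>f\<in>F. (norm (f z))\<^sup>2) \<le> S" if "finite F" "F \<subseteq> B" for F
    unfolding S_def
  proof (rule finite_sum_orthonormal_le_bergman_diagonal[OF k that(1) _ _ z1])
    show "F \<subseteq> bergman_space k" using that Bs by blast
    show "bergman_inner k f g = (if f = g then 1 else 0)" if "f \<in> F" "g \<in> F" for f g
      by (rule orth) (use that \<open>F \<subseteq> B\<close> in auto)
  qed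
  have summ: "(\<lambda>f. (norm (f z))\<^sup>2) summable_on B"
    by (rule nonneg_bdd_above_summable_on) (use fin in \<open>auto intro!: bdd_aboveI[of _ S]\<close>)
  have T: "T \<ge> 0" unfolding T_def by (rule infsum_nonneg) simp
  have "T \<le> S" unfolding T_def by (rule infsum_le_finite_sums[OF summ fin])
  have S: "S \<ge> 0" using T \<open>T \<le> S\<close> by linarith
  define SN where "SN N = (\<Sum>n\<in>{1..N}. norm z ^ (2 * n) / monomial_norm2 k n)" for N
  have SN_le: "SN N \<le> T" for N
  proof -
    let ?e = "monomial_basis k"
    define E where "E = ?e ` {1..N}"
    have Es: "E \<subseteq> bergman_space k" "finite E"
      using monomial_basis_in_bergman_space[OF k] by (auto simp: E_def)
    have inj: "inj_on ?e {1..N}"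
      by (rule inj_on_subset[OF inj_on_monomial_basis[OF k]]) auto
    \<comment> \<open>The truncated reproducing kernel at \<open>z\<close>; approximating it from
      the span of \<open>B\<close> bounds the partial sum \<open>SN N\<close> in terms of T.\<close>
    define q where "q w = (\<Sum>b\<in>E. cnj (b z) * b w)" for w
    have q_space: "q \<in> bergman_space k"
      unfolding q_def by (rule bergman_space_sum[OF k Es(2,1)])
    have sum_E: "(\<Sum>b\<in>E. (norm (b z))\<^sup>2) = SN N"
      unfolding SN_def E_def sum.reindex[OF inj] o_def
      by (intro sum.cong refl)
         (use z monomial_norm2_pos in \<open>auto simp: monomial_basis_def norm_divide norm_power power_divide mult.commute simp flip: power_mult\<close>)
    have qz: "q z = of_real (SN N)"
      unfolding sum_E[symmetric] q_def of_real_sum complex_norm_square by (simp add: mult.commute)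
    have q_norm: "(bergman_norm k q)\<^sup>2 = SN N"
    proof -
      have "bergman_inner k f g = (if f = g then 1 else 0)" if "f \<in> E" "g \<in> E" for f g
        using that bergman_orthonormal_basis_monomial[OF k]
        unfolding bergman_orthonormal_basis_def E_def by force
      from bergman_norm_sum_square[OF k Es(2,1) this, of "\<lambda>b. cnj (b z)"] show ?thesis
        by (simp add: q_def[abs_def] sum_E)
    qed
    have SN0: "SN N \<ge> 0" unfolding SN_def by (intro sum_nonneg) auto
    \<comment> \<open>The first term bounds the approximation error at \<open>z\<close>, the second
      the value of the approximant, by Cauchy-Schwarz and Pythagoras. The parameter d of
      \<open>bergman_norm_add_square_le\<close> is taken to be \<epsilon>, so that (1 + 1 /
      \<epsilon>) \<epsilon>^2 = \<epsilon>^2 + \<epsilon> tends to 0.\<close>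
    have bound: "SN N \<le> sqrt S * \<epsilon> + sqrt (((1 + \<epsilon>) * SN N + (\<epsilon>\<^sup>2 + \<epsilon>)) * T)" if \<epsilon>: "\<epsilon> > 0" for \<epsilon>
    proof -
      obtain F c where F: "finite F" "F \<subseteq> B"
        and close: "bergman_norm k (\<lambda>z. q z - (\<Sum>b\<in>F. c b * b z)) < \<epsilon>"
        using dense[OF q_space \<epsilon>] by blast
      define s where "s w = (\<Sum>b\<in>F. c b * b w)" for w
      have s_space: "s \<in> bergman_space k"
        unfolding s_def using F Bs by (intro bergman_space_sum[OF k]) auto
      have d_space: "(\<lambda>w. q w - s w) \<in> bergman_space k"
        using bergman_space_lincomb[OF k q_space s_space, of 1 "-1"] by simp
      have d'_space: "(\<lambda>w. s w - q w) \<in> bergman_space k"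
        using bergman_space_lincomb[OF k q_space s_space, of "-1" 1] by simp
      have d_norm: "(bergman_norm k (\<lambda>w. q w - s w))\<^sup>2 \<le> \<epsilon>\<^sup>2"
        using close bergman_norm_nonneg by (intro power_mono) (auto simp: s_def)
      have d'_norm: "(bergman_norm k (\<lambda>w. s w - q w))\<^sup>2 \<le> \<epsilon>\<^sup>2"
        using d_norm by (simp add: bergman_norm_def norm_minus_commute)
      have "(norm (q z - s z))\<^sup>2 \<le> (bergman_norm k (\<lambda>w. q w - s w))\<^sup>2 * S"
        unfolding S_def by (rule norm_square_le_bergman_diagonal[OF k d_space z1])
      also have "\<dots> \<le> \<epsilon>\<^sup>2 * S" using d_norm S by (rule mult_right_mono)
      finally have "norm (q z - s z) \<le> sqrt (\<epsilon>\<^sup>2 * S)" by (rule real_le_rsqrt)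
      hence 1: "norm (q z - s z) \<le> sqrt S * \<epsilon>"
        using \<epsilon> by (simp add: real_sqrt_mult mult.commute)
      have "(norm (s z))\<^sup>2 \<le> (\<Sum>b\<in>F. norm (c b) * norm (b z))\<^sup>2"
        unfolding s_def by (intro power_mono order.trans[OF norm_sum]) (auto simp: norm_mult)
      also have "\<dots> \<le> (\<Sum>b\<in>F. (norm (c b))\<^sup>2) * (\<Sum>b\<in>F. (norm (b z))\<^sup>2)"
        by (rule Cauchy_Schwarz_ineq_sum)
      also have "(\<Sum>b\<in>F. (norm (c b))\<^sup>2) = (bergman_norm k s)\<^sup>2"
        unfolding s_def
      proof (rule bergman_norm_sum_square[OF k F(1), symmetric])
        show "F \<subseteq> bergman_space k" using F Bs by blast
        show "bergman_inner k f g = (if f = g then 1 else 0)" if "f \<in> F" "g \<in> F" for f g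
          by (rule orth) (use that F in auto)
      qed
      also have "(bergman_norm k s)\<^sup>2 = (bergman_norm k (\<lambda>w. q w + (s w - q w)))\<^sup>2"
        by simp
      also have "\<dots> * (\<Sum>b\<in>F. (norm (b z))\<^sup>2) \<le> ((1 + \<epsilon>) * SN N + (\<epsilon>\<^sup>2 + \<epsilon>)) * T"
      proof (rule mult_mono)
        have "(bergman_norm k (\<lambda>w. q w + (s w - q w)))\<^sup>2 \<le>
            (1 + \<epsilon>) * SN N + (1 + 1 / \<epsilon>) * (bergman_norm k (\<lambda>w. s w - q w))\<^sup>2"
          using bergman_norm_add_square_le[OF k q_space d'_space \<epsilon>] q_norm by simp
        also have "\<dots> \<le> (1 + \<epsilon>) * SN N + (1 + 1 / \<epsilon>) * \<epsilon>\<^sup>2"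
          using d'_norm \<epsilon> by (intro add_left_mono mult_left_mono) auto
        also have "(1 + 1 / \<epsilon>) * \<epsilon>\<^sup>2 = \<epsilon>\<^sup>2 + \<epsilon>"
          using \<epsilon> by (simp add: field_simps power2_eq_square)
        finally show "(bergman_norm k (\<lambda>w. q w + (s w - q w)))\<^sup>2 \<le> (1 + \<epsilon>) * SN N + (\<epsilon>\<^sup>2 + \<epsilon>)" .
        show "(\<Sum>b\<in>F. (norm (b z))\<^sup>2) \<le> T"
          unfolding T_def by (rule finite_sum_le_infsum[OF summ F]) simp
      qed (use \<epsilon> SN0 in \<open>auto intro!: sum_nonneg add_nonneg_nonneg mult_nonneg_nonneg\<close>)
      finally have 2: "norm (s z) \<le> sqrt (((1 + \<epsilon>) * SN N + (\<epsilon>\<^sup>2 + \<epsilon>)) * T)"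
        by (rule real_le_rsqrt)
      have "SN N = norm (q z)" using qz SN0 by simp
      also have "\<dots> \<le> norm (q z - s z) + norm (s z)"
        using norm_triangle_ineq[of "q z - s z" "s z"] by simp
      finally show ?thesis using 1 2 by linarith
    qed
    \<comment> \<open>In the limit \<epsilon> to 0 the estimate becomes SN^2 <= SN T, hence SN <=
      T.\<close>
    have "((\<lambda>\<epsilon>. sqrt S * \<epsilon> + sqrt (((1 + \<epsilon>) * SN N + (\<epsilon>\<^sup>2 + \<epsilon>)) * T)) \<longlongrightarrow>
             sqrt S * 0 + sqrt (((1 + 0) * SN N + (0\<^sup>2 + 0)) * T)) (at_right 0)"
      by (intro tendsto_intros)
    moreover have "eventually (\<lambda>\<epsilon>. SN N \<le> sqrt S * \<epsilon> + sqrt (((1 + \<epsilon>) * SN N + (\<epsilon>\<^sup>2 + \<epsilon>)) * T)) (at_right 0)"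
      using eventually_at_right_less[of 0] by eventually_elim (rule bound)
    ultimately have "SN N \<le> sqrt S * 0 + sqrt (((1 + 0) * SN N + (0\<^sup>2 + 0)) * T)"
      by (intro tendsto_lowerbound) auto
    hence "SN N \<le> sqrt (SN N * T)" by simp
    hence "(SN N)\<^sup>2 \<le> (sqrt (SN N * T))\<^sup>2"
      using SN0 by (rule power_mono)
    also have "(sqrt (SN N * T))\<^sup>2 = SN N * T"
      using SN0 T by simp
    finally have "SN N * SN N \<le> SN N * T" by (simp add: power2_eq_square)
    thus "SN N \<le> T"
      using SN0 T by (cases "SN N = 0") auto
  qed
  have "(\<lambda>N. \<Sum>n\<le>N. norm z ^ (2 * n) / monomial_norm2 k n) \<longlonglongrightarrow> S"
    using summable_sums[OF summable_bergman_diagonal[OF z1, of k]]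
    by (simp add: sums_def_le S_def bergman_diagonal_def)
  \<comment> \<open>The term n = 0 vanishes because \<open>monomial_norm2 k 0 = 0\<close> and
    division by zero yields 0.\<close>
  moreover have "(\<Sum>n\<le>N. norm z ^ (2 * n) / monomial_norm2 k n) = SN N" for N
    unfolding SN_def
    by (rule sum.mono_neutral_right) (use monomial_norm2_0[OF k] in \<open>auto simp: Suc_le_eq\<close>)
  ultimately have "SN \<longlonglongrightarrow> S" by simp
  hence "S \<le> T" using SN_le by (intro LIMSEQ_le_const2) auto
  thus ?thesis using \<open>T \<le> S\<close> by (simp add: S_def T_def)
qed

section \<open>The explicit kernel and its limit at the unit circle\<close>

lemma bergman_kernel_function_eq:
  assumes k: "k \<ge> 2" and z: "z \<in> punctured_disk"
  shows "bergman_kernel_function k z =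
           log_weight z ^ k / (2 * pi * fact (k - 2)) * (\<Sum>n. real n ^ (k - 1) * (norm z ^ 2) ^ n)"
proof -
  \<comment> \<open>The monomials witness that an orthonormal basis exists, so \<open>SOME\<close>
    denotes one; which one is immaterial by \<open>infsum_orthonormal_basis\<close>.\<close>
  have "bergman_orthonormal_basis k (SOME B. bergman_orthonormal_basis k B)"
    using bergman_orthonormal_basis_monomial[OF k] by (rule someI)
  from infsum_orthonormal_basis[OF k this z] show ?thesis
    using bergman_diagonal_eq[of z k] z by (simp add: bergman_kernel_function_def punctured_disk_def)
qed

text \<open>The filter expresses that |z| tends to 1 within |z| < 1. On the punctured disk the
  kernel depends on |z| alone, so the claim reduces to a limit in the single real variable
  r^2.\<close>

theorem corollary1p2:
  fixes k :: nat
  assumes "k \<ge> 3"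
  shows "((\<lambda>z::complex. bergman_kernel_function (k + 1) z) \<longlongrightarrow> real k / (2 * pi))
           (filtercomap norm (at_left (1::real)))"
proof -
  \<comment> \<open>The kernel of index k + 1 as a function of the radius: (k + 1) - 1 = k is the
    exponent of n, and (k + 1) - 2 = k - 1 appears in the factorial.\<close>
  define g where "g r = ln (1 / r\<^sup>2) ^ Suc k * (\<Sum>n. real n ^ k * (r\<^sup>2) ^ n) / (2 * pi * fact (k - 1))" for r :: real
  have "filterlim (\<lambda>r::real. r\<^sup>2) (at_left 1) (at_left 1)"
    by real_asymp
  hence "((\<lambda>r. ln (1 / r\<^sup>2) ^ Suc k * (\<Sum>n. real n ^ k * (r\<^sup>2) ^ n)) \<longlongrightarrow> fact k) (at_left (1::real))"
    by (rule filterlim_compose[OF tendsto_ln_power_times_suminf])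
  hence "(g \<longlongrightarrow> fact k / (2 * pi * fact (k - 1))) (at_left 1)"
    unfolding g_def by (intro tendsto_divide tendsto_const) auto
  also have "fact k / (2 * pi * fact (k - 1)) = real k / (2 * pi)"
    using assms fact_reduce[of k, where ?'a = real] by simp
  finally have "((\<lambda>z::complex. g (norm z)) \<longlongrightarrow> real k / (2 * pi)) (filtercomap norm (at_left 1))"
    by (rule filterlim_compose) (rule filterlim_filtercomap)
  moreover have "eventually (\<lambda>z::complex. g (norm z) = bergman_kernel_function (k + 1) z) (filtercomap norm (at_left 1))"
  proof -
    have "eventually (\<lambda>r::real. 0 < r \<and> r < 1) (at_left 1)"
      using eventually_at_left_real[of 0 "1::real"] by simp
    hence "eventually (\<lambda>z::complex. 0 < norm z \<and> norm z < 1) (filtercomap norm (at_left 1))"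
      by (rule eventually_filtercomapI)
    thus ?thesis
    proof eventually_elim
      case (elim z)
      hence "z \<in> punctured_disk" by (simp add: punctured_disk_def)
      thus ?case
        using bergman_kernel_function_eq[of "k + 1" z] assms
        by (simp add: g_def log_weight_def)
    qed
  qed
  ultimately show ?thesis by (rule Lim_transform_eventually)
qed

end
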